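(* Let $\Gamma$ be a nonelementary discrete subgroup of $\mathrm{Sp}(1,1)$. Then the trace field of $\Gamma$ is contained in $\mathbb R$ if and only if $\Gamma$ is conjugate to a subgroup of $\mathrm{SU}(1,1)$ by an element of $\mathrm{Sp}(1)$, i.e. there is a unit quaternion $h$ with $(hI_2)^{-1}\Gamma(hI_2)\subset\mathrm{SU}(1,1)$.
   Context: $\mathbb H$ denotes the quaternions. $\mathrm{Sp}(1,1)=\{A\in\mathrm{GL}(2,\mathbb H): A^*I_{1,1}A=I_{1,1}\}$, $I_{1,1}=\mathrm{diag}(1,-1)$, acting on quaternionic hyperbolic line $\mathbf H^1_{\mathbb H}$; nonelementary means the limit set in $\partial\mathbf H^1_{\mathbb H}$ has more than two points. $\mathrm{SU}(1,1)$ is the subgroup of complex matrices of determinant $1$ in $\mathrm{Sp}(1,1)$. $\mathrm{Sp}(1)$ is the group of unit quaternions $h$, identified with the scalar matrices $hI_2$. The trace of a matrix is the sum of its diagonal entries; the trace field of $\Gamma$ is the skew field generated over $\mathbb Q$ by the traces of its elements. *)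

theory Defs
  imports Complex_Main
begin

datatype quat = Quat (qre: real) (qi: real) (qj: real) (qk: real)

instantiation quat :: ring_1
begin
definition "0 = Quat 0 0 0 0"
definition "1 = Quat 1 0 0 0"
definition "p + q = Quat (qre p + qre q) (qi p + qi q) (qj p + qj q) (qk p + qk q)"
definition "- p = Quat (- qre p) (- qi p) (- qj p) (- qk p)"
definition "p - q = Quat (qre p - qre q) (qi p - qi q) (qj p - qj q) (qk p - qk q)"
definition "p * q = Quat
   (qre p * qre q - qi p * qi q - qj p * qj q - qk p * qk q)
   (qre p * qi q + qi p * qre q + qj p * qk q - qk p * qj q)
   (qre p * qj q - qi p * qk q + qj p * qre q + qk p * qi q)
   (qre p * qk q + qi p * qj q - qj p * qi q + qk p * qre q)"
instance
  by standard (auto simp: zero_quat_def one_quat_def plus_quat_def uminus_quat_def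
      minus_quat_def times_quat_def algebra_simps intro: quat.expand)
end

text \<open>Quaternionic conjugate, norm, and inverse (with inverse 0 = 0).\<close>
definition qconj :: "quat \<Rightarrow> quat" where
  "qconj q = Quat (qre q) (- qi q) (- qj q) (- qk q)"

definition qnorm :: "quat \<Rightarrow> real" where
  "qnorm q = sqrt ((qre q)\<^sup>2 + (qi q)\<^sup>2 + (qj q)\<^sup>2 + (qk q)\<^sup>2)"

instantiation quat :: inverse
begin
definition "inverse q =
  (let n = (qre q)\<^sup>2 + (qi q)\<^sup>2 + (qj q)\<^sup>2 + (qk q)\<^sup>2
   in Quat (qre q / n) (- qi q / n) (- qj q / n) (- qk q / n))"
definition "p div q = p * inverse (q :: quat)"
instance ..
end

definition qreal :: "real \<Rightarrow> quat" where
  "qreal r = Quat r 0 0 0"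

definition is_complex_quat :: "quat \<Rightarrow> bool" where
  "is_complex_quat q \<longleftrightarrow> qj q = 0 \<and> qk q = 0"

datatype mat2 = M2 (m11: quat) (m12: quat) (m21: quat) (m22: quat)

definition mmult :: "mat2 \<Rightarrow> mat2 \<Rightarrow> mat2" where
  "mmult A B = M2
     (m11 A * m11 B + m12 A * m21 B) (m11 A * m12 B + m12 A * m22 B)
     (m21 A * m11 B + m22 A * m21 B) (m21 A * m12 B + m22 A * m22 B)"

definition mid :: mat2 where "mid = M2 1 0 0 1"

definition mscal :: "quat \<Rightarrow> mat2" where "mscal h = M2 h 0 0 h"

definition mstar :: "mat2 \<Rightarrow> mat2" where
  "mstar A = M2 (qconj (m11 A)) (qconj (m21 A)) (qconj (m12 A)) (qconj (m22 A))"

definition I11 :: mat2 where "I11 = M2 1 0 0 (-1)"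

definition mtrace :: "mat2 \<Rightarrow> quat" where "mtrace A = m11 A + m22 A"

definition invertible2 :: "mat2 \<Rightarrow> bool" where
  "invertible2 A \<longleftrightarrow> (\<exists>B. mmult A B = mid \<and> mmult B A = mid)"

definition mdist :: "mat2 \<Rightarrow> mat2 \<Rightarrow> real" where
  "mdist A B = sqrt ((qnorm (m11 A - m11 B))\<^sup>2 + (qnorm (m12 A - m12 B))\<^sup>2
                   + (qnorm (m21 A - m21 B))\<^sup>2 + (qnorm (m22 A - m22 B))\<^sup>2)"

definition Sp11 :: "mat2 set" where
  "Sp11 = {A. invertible2 A \<and> mmult (mmult (mstar A) I11) A = I11}"

definition SU11 :: "mat2 set" where
  "SU11 = {A. A \<in> Sp11 \<and> is_complex_quat (m11 A) \<and> is_complex_quat (m12 A)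
              \<and> is_complex_quat (m21 A) \<and> is_complex_quat (m22 A)
              \<and> m11 A * m22 A - m12 A * m21 A = 1}"

definition subgroup_Sp11 :: "mat2 set \<Rightarrow> bool" where
  "subgroup_Sp11 G \<longleftrightarrow> G \<subseteq> Sp11 \<and> mid \<in> G
     \<and> (\<forall>A\<in>G. \<forall>B\<in>G. mmult A B \<in> G)
     \<and> (\<forall>A\<in>G. \<exists>B\<in>G. mmult A B = mid \<and> mmult B A = mid)"

definition discrete_set :: "mat2 set \<Rightarrow> bool" where
  "discrete_set G \<longleftrightarrow> (\<forall>A\<in>G. \<exists>e>0. \<forall>B\<in>G. mdist A B < e \<longrightarrow> B = A)"

text \<open>H^1_H is the unit ball {q. qnorm q < 1} (points [z:1] of negative vectors for the
  form |z1|^2 - |z2|^2, with coordinate z = z1 z2^{-1}); its boundary is the unit sphere.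
  A acts by z \<mapsto> (a z + b)(c z + d)^{-1}.\<close>
definition mobius :: "mat2 \<Rightarrow> quat \<Rightarrow> quat" where
  "mobius A z = (m11 A * z + m12 A) * inverse (m21 A * z + m22 A)"

definition limit_set :: "mat2 set \<Rightarrow> quat set" where
  "limit_set G = {p. qnorm p = 1 \<and>
     (\<exists>g :: nat \<Rightarrow> mat2. (\<forall>n. g n \<in> G) \<and> (\<lambda>n. qnorm (mobius (g n) 0 - p)) \<longlonglongrightarrow> 0)}"

definition nonelementary :: "mat2 set \<Rightarrow> bool" where
  "nonelementary G \<longleftrightarrow> (\<exists>p q r. p \<in> limit_set G \<and> q \<in> limit_set G \<and> r \<in> limit_set G
                         \<and> p \<noteq> q \<and> q \<noteq> r \<and> p \<noteq> r)"

inductive_set trace_field :: "mat2 set \<Rightarrow> quat set" for G where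
  tf_trace: "A \<in> G \<Longrightarrow> mtrace A \<in> trace_field G"
| tf_one: "1 \<in> trace_field G"
| tf_add: "x \<in> trace_field G \<Longrightarrow> y \<in> trace_field G \<Longrightarrow> x + y \<in> trace_field G"
| tf_neg: "x \<in> trace_field G \<Longrightarrow> - x \<in> trace_field G"
| tf_mult: "x \<in> trace_field G \<Longrightarrow> y \<in> trace_field G \<Longrightarrow> x * y \<in> trace_field G"
| tf_inv: "x \<in> trace_field G \<Longrightarrow> x \<noteq> 0 \<Longrightarrow> inverse x \<in> trace_field G"

end

theory Submission
  imports Defs "HOL-Analysis.Analysis"
begin

text \<open>
  If all traces of \<open>\<Gamma>\<close> are real, then so are all traces of the closed real algebra \<open>V\<close> spanned
  by \<open>\<Gamma>\<close>. Writing \<open>v_p = (p, 1)\<close>, rescaled sequences in \<open>\<Gamma>\<close> that converge to a limit point \<open>p\<close> produce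
  rank-one elements \<open>v_p d v_q^*\<close> of \<open>V\<close>. Since \<open>\<Gamma>\<close> is discrete and nonelementary, it fixes no
  boundary point, and so products of these yield \<open>v_p d v_p^* \<in> V\<close> with \<open>d \<noteq> 0\<close> for every limit point
  \<open>p\<close>. Reality of the traces of products of such elements for three limit points forces every \<open>d\<close> to be
  purely imaginary and all of them to lie on one line \<open>\<real> u\<close> that commutes with the limit points. Each
  \<open>A \<in> \<Gamma>\<close> permutes the lines \<open>v_p \<real> u v_p^*\<close>, which together with \<open>tr (A v_p u v_p^*) \<in> \<real>\<close> shows that the
  entries of \<open>A\<close> commute with \<open>u\<close> and that \<open>A\<close> has the shape of an element of \<open>SU(1,1)\<close> over
  \<open>\<real>[u]\<close>. A unit quaternion \<open>h\<close> with \<open>h^{-1} u h \<in> \<real> i\<close> finishes the proof.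
\<close>

section \<open>Quaternions as a normed division algebra\<close>

lemma quat_eq_iff: "x = y \<longleftrightarrow> qre x = qre y \<and> qi x = qi y \<and> qj x = qj y \<and> qk x = qk y"
  by (auto intro: quat.expand)

lemma quat_sel_simps [simp]:
  "qre 0 = 0" "qi 0 = 0" "qj 0 = 0" "qk 0 = 0"
  "qre 1 = 1" "qi 1 = 0" "qj 1 = 0" "qk 1 = 0"
  "qre (x + y) = qre x + qre y" "qi (x + y) = qi x + qi y"
  "qj (x + y) = qj x + qj y" "qk (x + y) = qk x + qk y"
  "qre (x - y) = qre x - qre y" "qi (x - y) = qi x - qi y"
  "qj (x - y) = qj x - qj y" "qk (x - y) = qk x - qk y"
  "qre (- x) = - qre x" "qi (- x) = - qi x" "qj (- x) = - qj x" "qk (- x) = - qk x"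
  "qre (qconj x) = qre x" "qi (qconj x) = - qi x" "qj (qconj x) = - qj x" "qk (qconj x) = - qk x"
  by (simp_all add: zero_quat_def one_quat_def plus_quat_def minus_quat_def uminus_quat_def qconj_def)

lemma quat_sel_mult:
  "qre (x * y) = qre x * qre y - qi x * qi y - qj x * qj y - qk x * qk y"
  "qi (x * y) = qre x * qi y + qi x * qre y + qj x * qk y - qk x * qj y"
  "qj (x * y) = qre x * qj y - qi x * qk y + qj x * qre y + qk x * qi y"
  "qk (x * y) = qre x * qk y + qi x * qj y - qj x * qi y + qk x * qre y"
  by (simp_all add: times_quat_def)

instantiation quat :: real_vector
begin
definition "scaleR r x = Quat (r * qre x) (r * qi x) (r * qj x) (r * qk x)" for x :: quat
instance
  by standard (simp_all add: scaleR_quat_def quat_eq_iff algebra_simps)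
end

instantiation quat :: real_inner
begin
definition "inner x y = qre x * qre y + qi x * qi y + qj x * qj y + qk x * qk y" for x y :: quat
definition "norm x = qnorm x" for x :: quat
definition "dist x y = norm (x - y)" for x y :: quat
definition "sgn x = x /\<^sub>R norm x" for x :: quat
definition
  "(uniformity :: (quat \<times> quat) filter) = (INF e\<in>{0<..}. principal {(x, y). dist x y < e})"
definition
  "open U = (\<forall>x\<in>U. \<forall>\<^sub>F (x', y) in uniformity. x' = x \<longrightarrow> y \<in> U)" for U :: "quat set"
instance
proof
  fix x y z :: quat and r :: real
  show "inner x y = inner y x" "inner (x + y) z = inner x z + inner y z"
    "inner (r *\<^sub>R x) y = r * inner x y" "0 \<le> inner x x"
    by (simp_all add: inner_quat_def scaleR_quat_def algebra_simps)
  have "a*a + b*b + c*c + d*d = 0 \<longleftrightarrow> a = 0 \<and> b = 0 \<and> c = 0 \<and> d = 0" for a b c d :: real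
    by (auto simp: add_nonneg_eq_0_iff)
  then show "inner x x = 0 \<longleftrightarrow> x = 0"
    by (simp add: inner_quat_def quat_eq_iff)
  show "norm x = sqrt (inner x x)"
    by (simp add: norm_quat_def qnorm_def inner_quat_def power2_eq_square)
qed (simp_all add: dist_quat_def sgn_quat_def uniformity_quat_def open_quat_def)
end

lemma quat_sel_scaleR [simp]:
  "qre (r *\<^sub>R x) = r * qre x" "qi (r *\<^sub>R x) = r * qi x" "qj (r *\<^sub>R x) = r * qj x" "qk (r *\<^sub>R x) = r * qk x"
  by (simp_all add: scaleR_quat_def)

lemma norm_quat_square: "(norm x)\<^sup>2 = (qre x)\<^sup>2 + (qi x)\<^sup>2 + (qj x)\<^sup>2 + (qk x)\<^sup>2" for x :: quat
  by (simp add: norm_quat_def qnorm_def)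

lemma quat_inverse_eq: "inverse x = inverse ((norm x)\<^sup>2) *\<^sub>R qconj x" for x :: quat
  by (simp add: inverse_quat_def norm_quat_square quat_eq_iff Let_def divide_inverse)

lemma quat_mult_qconj:
  "x * qconj x = (norm x)\<^sup>2 *\<^sub>R 1" "qconj x * x = (norm x)\<^sup>2 *\<^sub>R 1"
  unfolding norm_quat_square by (simp_all add: quat_eq_iff quat_sel_mult power2_eq_square)

instance quat :: real_normed_div_algebra
proof
  fix x y :: quat and r :: real
  show scale: "r *\<^sub>R x * y = r *\<^sub>R (x * y)" "x * r *\<^sub>R y = r *\<^sub>R (x * y)" for r and x y :: quat
    by (simp_all add: quat_eq_iff quat_sel_mult right_diff_distrib distrib_left mult.left_commute)
  have "(norm (x * y))\<^sup>2 = (norm x * norm y)\<^sup>2"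
    unfolding power_mult_distrib norm_quat_square quat_sel_mult
    by (simp add: power2_eq_square algebra_simps)
  then show "norm (x * y) = norm x * norm y"
    by (simp add: power2_eq_iff_nonneg)
  show "x / y = x * inverse y"
    by (simp add: divide_quat_def)
  show "inverse (0::quat) = 0"
    by (simp add: inverse_quat_def quat_eq_iff)
  assume "x \<noteq> 0"
  then show "inverse x * x = 1" "x * inverse x = 1"
    by (simp_all add: quat_inverse_eq scale quat_mult_qconj)
qed

text \<open>Finite real dimension is what yields convergent subsequences of bounded sequences of
  matrices and the surjectivity of injective real-linear maps on quaternions.\<close>

instantiation quat :: euclidean_space
begin
definition "Basis = {Quat 1 0 0 0, Quat 0 1 0 0, Quat 0 0 1 0, Quat 0 0 0 1}"
instance
proof
  show "(Basis :: quat set) \<noteq> {}" "finite (Basis :: quat set)"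
    by (simp_all add: Basis_quat_def)
  fix u v x :: quat
  show "u \<in> Basis \<Longrightarrow> v \<in> Basis \<Longrightarrow> inner u v = (if u = v then 1 else 0)"
    unfolding Basis_quat_def by (elim insertE emptyE) (simp_all add: inner_quat_def)
  show "(\<forall>u\<in>Basis. inner x u = 0) \<longleftrightarrow> x = 0"
    unfolding Basis_quat_def by (simp add: inner_quat_def quat_eq_iff[of x])
qed
end

lemma quat_sel_of_real [simp]:
  "qre (of_real r) = r" "qi (of_real r) = 0" "qj (of_real r) = 0" "qk (of_real r) = 0"
  by (simp_all add: of_real_def)

lemma qreal_eq_of_real: "qreal r = of_real r"
  by (simp add: qreal_def quat_eq_iff)

lemma qconj_simps [simp]:
  "qconj 0 = 0" "qconj 1 = 1" "qconj (x + y) = qconj x + qconj y" "qconj (x - y) = qconj x - qconj y"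
  "qconj (- x) = - qconj x" "qconj (qconj x) = x" "qconj (r *\<^sub>R x) = r *\<^sub>R qconj x"
  "qconj (of_real r) = of_real r"
  by (simp_all add: quat_eq_iff)

lemma quat_sel_numeral [simp]:
  "qre (numeral n) = numeral n" "qi (numeral n) = 0" "qj (numeral n) = 0" "qk (numeral n) = 0"
  "qconj (numeral n) = numeral n"
  using quat_sel_of_real[of "numeral n"] qconj_simps(8)[of "numeral n"] by simp_all

lemma qconj_mult [simp]: "qconj (x * y) = qconj y * qconj x"
  by (simp add: quat_eq_iff quat_sel_mult)

lemma qconj_eq_0_iff [simp]: "qconj x = 0 \<longleftrightarrow> x = 0"
  by (auto simp: quat_eq_iff)

lemma norm_qconj [simp]: "norm (qconj x) = norm x"
  by (simp add: norm_quat_def qnorm_def)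

lemma qconj_real_iff: "qconj x = x \<longleftrightarrow> x \<in> \<real>"
  by (auto simp: quat_eq_iff Reals_def intro!: image_eqI[of _ _ "qre x"])

lemma mult_qconj: "x * qconj x = of_real ((norm x)\<^sup>2)" "qconj x * x = of_real ((norm x)\<^sup>2)"
  by (simp_all add: quat_mult_qconj of_real_def)

lemma unit_qconj:
  assumes "norm p = 1"
  shows "p * qconj p = 1" "qconj p * p = 1" "p * (qconj p * x) = x" "qconj p * (p * x) = x"
proof -
  show *: "p * qconj p = 1" "qconj p * p = 1"
    using assms by (simp_all add: mult_qconj)
  show "p * (qconj p * x) = x" "qconj p * (p * x) = x"
    by (simp_all add: mult.assoc[symmetric] *)
qed

lemma inverse_unit: "norm p = 1 \<Longrightarrow> inverse p = qconj p" for p :: quat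
  by (rule inverse_unique) (simp add: unit_qconj)

lemma qre_mult_commute: "qre (x * y) = qre (y * x)"
  by (simp add: quat_sel_mult)

lemma quat_real_commute: "x \<in> \<real> \<Longrightarrow> x * y = y * x" for x y :: quat
  by (auto simp: Reals_def scaleR_conv_of_real[symmetric] of_real_def)

lemma bounded_linear_qconj: "bounded_linear qconj"
  by (rule bounded_linear_intro[of _ 1]) simp_all

lemmas tendsto_qconj [tendsto_intros] = bounded_linear.tendsto[OF bounded_linear_qconj]

lemma abs_qre_le_norm: "\<bar>qre x\<bar> \<le> norm x"
  using norm_quat_square[of x] by (intro abs_le_square_iff[THEN iffD2, of "qre x" "norm x", simplified]) simp

lemma bounded_linear_qre: "bounded_linear qre"
  by (rule bounded_linear_intro[of _ 1]) (simp_all add: abs_qre_le_norm)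

lemmas tendsto_qre [tendsto_intros] = bounded_linear.tendsto[OF bounded_linear_qre]

text \<open>The commutator of \<open>x\<close> and \<open>d\<close> is twice the cross product of
  their imaginary parts. When it vanishes, the imaginary part of \<open>x\<close> is its own
  projection \<open>b *\<^sub>R d\<close>, so the centralizer of \<open>d\<close> is the plane
  \<open>\<real>[d]\<close>.\<close>

lemma imaginary_commute_scaleR:
  assumes "qconj d = - d" "d \<noteq> 0" "x * d = d * x"
  obtains a b where "x = of_real a + b *\<^sub>R d"
proof -
  have d0: "qre d = 0"
    using assms(1) by (simp add: quat_eq_iff)
  define n where "n = (qi d)\<^sup>2 + (qj d)\<^sup>2 + (qk d)\<^sup>2"
  have n: "n \<noteq> 0"
    using assms(2) d0 by (simp add: n_def quat_eq_iff add_nonneg_eq_0_iff)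
  have c: "qi x * qj d = qj x * qi d" "qi x * qk d = qk x * qi d" "qj x * qk d = qk x * qj d"
    using assms(3) by (auto simp: quat_eq_iff quat_sel_mult algebra_simps)
  define b where "b = (qi x * qi d + qj x * qj d + qk x * qk d) / n"
  have "n * (qi x) = (qi x * qi d + qj x * qj d + qk x * qk d) * qi d"
       "n * (qj x) = (qi x * qi d + qj x * qj d + qk x * qk d) * qj d"
       "n * (qk x) = (qi x * qi d + qj x * qj d + qk x * qk d) * qk d"
    using c unfolding n_def by algebra+
  then have "qi x = b * qi d" "qj x = b * qj d" "qk x = b * qk d"
    using n by (simp_all add: b_def field_simps)
  then have "x = of_real (qre x) + b *\<^sub>R d"
    using d0 by (simp add: quat_eq_iff)
  then show ?thesis by (rule that)
qed

section \<open>Matrices and the adjoint of the form\<close>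

lemma mat2_eq_iff: "A = B \<longleftrightarrow> m11 A = m11 B \<and> m12 A = m12 B \<and> m21 A = m21 B \<and> m22 A = m22 B"
  by (auto intro: mat2.expand)

instantiation mat2 :: ring_1
begin
definition "0 = M2 0 0 0 0"
definition "1 = mid"
definition "A + B = M2 (m11 A + m11 B) (m12 A + m12 B) (m21 A + m21 B) (m22 A + m22 B)"
definition "- A = M2 (- m11 A) (- m12 A) (- m21 A) (- m22 A)"
definition "A - B = M2 (m11 A - m11 B) (m12 A - m12 B) (m21 A - m21 B) (m22 A - m22 B)"
definition "A * B = mmult A B"
instance
  by standard (simp_all add: zero_mat2_def one_mat2_def plus_mat2_def uminus_mat2_def minus_mat2_def
      times_mat2_def mmult_def mid_def mat2_eq_iff algebra_simps)
end

instantiation mat2 :: real_algebra_1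
begin
definition "scaleR r A = M2 (r *\<^sub>R m11 A) (r *\<^sub>R m12 A) (r *\<^sub>R m21 A) (r *\<^sub>R m22 A)"
instance
  by standard (simp_all add: scaleR_mat2_def plus_mat2_def times_mat2_def mmult_def mat2_eq_iff algebra_simps)
end

lemma mat2_sel_simps [simp]:
  "m11 0 = 0" "m12 0 = 0" "m21 0 = 0" "m22 0 = 0"
  "m11 1 = 1" "m12 1 = 0" "m21 1 = 0" "m22 1 = 1"
  "m11 (A + B) = m11 A + m11 B" "m12 (A + B) = m12 A + m12 B"
  "m21 (A + B) = m21 A + m21 B" "m22 (A + B) = m22 A + m22 B"
  "m11 (A - B) = m11 A - m11 B" "m12 (A - B) = m12 A - m12 B"
  "m21 (A - B) = m21 A - m21 B" "m22 (A - B) = m22 A - m22 B"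
  "m11 (- A) = - m11 A" "m12 (- A) = - m12 A" "m21 (- A) = - m21 A" "m22 (- A) = - m22 A"
  "m11 (r *\<^sub>R A) = r *\<^sub>R m11 A" "m12 (r *\<^sub>R A) = r *\<^sub>R m12 A"
  "m21 (r *\<^sub>R A) = r *\<^sub>R m21 A" "m22 (r *\<^sub>R A) = r *\<^sub>R m22 A"
  by (simp_all add: zero_mat2_def one_mat2_def mid_def plus_mat2_def minus_mat2_def uminus_mat2_def scaleR_mat2_def)

lemma mat2_sel_mult [simp]:
  "m11 (A * B) = m11 A * m11 B + m12 A * m21 B" "m12 (A * B) = m11 A * m12 B + m12 A * m22 B"
  "m21 (A * B) = m21 A * m11 B + m22 A * m21 B" "m22 (A * B) = m21 A * m12 B + m22 A * m22 B"
  by (simp_all add: times_mat2_def mmult_def)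

lemma mtrace_simps [simp]:
  "mtrace (A + B) = mtrace A + mtrace B" "mtrace (A - B) = mtrace A - mtrace B"
  "mtrace (r *\<^sub>R A) = r *\<^sub>R mtrace A"
  by (simp_all add: mtrace_def algebra_simps)

text \<open>Over the quaternions the trace itself is not cyclic. Its real part is, because
  \<open>qre\<close> is symmetric on products.\<close>

lemma qre_mtrace_commute: "qre (mtrace (A * B)) = qre (mtrace (B * A))"
  by (simp add: mtrace_def qre_mult_commute[of "m11 B"] qre_mult_commute[of "m12 B"]
      qre_mult_commute[of "m21 B"] qre_mult_commute[of "m22 B"])

text \<open>\<open>adj A = I11 A^* I11\<close>, the adjoint with respect to the form; it inverts the elements of \<open>Sp11\<close>.\<close>

definition adj :: "mat2 \<Rightarrow> mat2" where
  "adj A = M2 (qconj (m11 A)) (- qconj (m21 A)) (- qconj (m12 A)) (qconj (m22 A))"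

lemma adj_sel [simp]:
  "m11 (adj A) = qconj (m11 A)" "m12 (adj A) = - qconj (m21 A)"
  "m21 (adj A) = - qconj (m12 A)" "m22 (adj A) = qconj (m22 A)"
  by (simp_all add: adj_def)

lemma adj_adj [simp]: "adj (adj A) = A"
  by (simp add: mat2_eq_iff)

lemma adj_mult: "adj (A * B) = adj B * adj A"
  by (simp add: mat2_eq_iff)

lemma qre_mtrace_adj: "qre (mtrace (adj A)) = qre (mtrace A)"
  by (simp add: mtrace_def)

text \<open>Multiplying the defining equation by \<open>I11\<close>, whose square is 1, turns it
  into \<open>adj A * A = 1\<close>; invertibility makes this left inverse two-sided.\<close>

lemma Sp11_iff: "A \<in> Sp11 \<longleftrightarrow> adj A * A = 1 \<and> A * adj A = 1"
proof -
  have I: "adj A * A = I11 * (mmult (mmult (mstar A) I11) A)"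
    by (simp add: mat2_eq_iff I11_def mstar_def mmult_def)
  have II: "I11 * I11 = 1"
    by (simp add: mat2_eq_iff I11_def)
  have *: "mmult (mmult (mstar A) I11) A = I11 \<longleftrightarrow> adj A * A = 1"
    unfolding I using II by (metis mult.assoc mult_1 mult_1_right)
  have inv: "A * adj A = 1" if h: "adj A * A = 1" "invertible2 A"
  proof -
    obtain B where "A * B = 1"
      using h(2) by (auto simp: invertible2_def times_mat2_def one_mat2_def)
    then show ?thesis
      using h(1) by (metis mult.assoc mult_1 mult_1_right)
  qed
  show ?thesis
    unfolding Sp11_def mem_Collect_eq * using inv
    by (auto simp: invertible2_def times_mat2_def one_mat2_def)
qed

lemma Sp11_mult: "A \<in> Sp11 \<Longrightarrow> B \<in> Sp11 \<Longrightarrow> A * B \<in> Sp11"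
  unfolding Sp11_iff adj_mult by (metis mult.assoc mult_1)

text \<open>Read off from diagonal entries of \<open>A * adj A = 1\<close> and
  \<open>adj A * A = 1\<close>. Since \<open>m22 A\<close> never vanishes, \<open>mobius A 0\<close>
  is a genuine quotient.\<close>

lemma Sp11_norm:
  assumes "A \<in> Sp11"
  shows "(norm (m11 A))\<^sup>2 = 1 + (norm (m12 A))\<^sup>2" "(norm (m22 A))\<^sup>2 = 1 + (norm (m12 A))\<^sup>2"
    "norm (m11 A) = norm (m22 A)" "norm (m21 A) = norm (m12 A)" "m22 A \<noteq> 0"
proof -
  have "m11 (A * adj A) = 1" "m22 (adj A * A) = 1" "m22 (A * adj A) = 1"
    using assms by (simp_all add: Sp11_iff del: mat2_sel_mult)
  then have "qre (m11 (A * adj A)) = 1" "qre (m22 (adj A * A)) = 1" "qre (m22 (A * adj A)) = 1"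
    by (simp_all del: mat2_sel_mult)
  then have e: "(norm (m11 A))\<^sup>2 - (norm (m12 A))\<^sup>2 = 1" "(norm (m22 A))\<^sup>2 - (norm (m12 A))\<^sup>2 = 1"
    "(norm (m22 A))\<^sup>2 - (norm (m21 A))\<^sup>2 = 1"
    unfolding norm_quat_square by (simp_all add: quat_sel_mult power2_eq_square)
  show 1: "(norm (m11 A))\<^sup>2 = 1 + (norm (m12 A))\<^sup>2" "(norm (m22 A))\<^sup>2 = 1 + (norm (m12 A))\<^sup>2"
    using e(1,2) by (simp_all only: diff_eq_eq)
  show "norm (m11 A) = norm (m22 A)"
    using 1 by (intro power2_eq_imp_eq[OF _ norm_ge_zero norm_ge_zero]) (simp only:)
  show "norm (m21 A) = norm (m12 A)"
    using e(2,3) by (intro power2_eq_imp_eq[OF _ norm_ge_zero norm_ge_zero]) (simp only: diff_eq_eq add_left_cancel)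
  have "(norm (m22 A))\<^sup>2 \<noteq> 0"
    using 1(2) zero_le_power2[of "norm (m12 A)"] by linarith
  then show "m22 A \<noteq> 0"
    by simp
qed

section \<open>Consequences of real traces\<close>

lemma Sp11_form_invariant:
  assumes "A \<in> Sp11"
  shows "qconj (m21 A * x1 + m22 A * x2) * (m21 A * y1 + m22 A * y2)
       - qconj (m11 A * x1 + m12 A * x2) * (m11 A * y1 + m12 A * y2)
       = qconj x2 * y2 - qconj x1 * y1"
proof -
  have "m11 (adj A * A) = 1" "m12 (adj A * A) = 0" "m21 (adj A * A) = 0" "m22 (adj A * A) = 1"
    using assms by (simp_all add: Sp11_iff)
  then have "qconj (m11 A) * m11 A = qconj (m21 A) * m21 A + 1" "qconj (m21 A) * m22 A = qconj (m11 A) * m12 A"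
    "qconj (m22 A) * m21 A = qconj (m12 A) * m11 A" "qconj (m22 A) * m22 A = qconj (m12 A) * m12 A + 1"
    by (simp_all add: algebra_simps)
  then have "qconj (m11 A) * (m11 A * z) = qconj (m21 A) * (m21 A * z) + z"
    "qconj (m21 A) * (m22 A * z) = qconj (m11 A) * (m12 A * z)"
    "qconj (m22 A) * (m21 A * z) = qconj (m12 A) * (m11 A * z)"
    "qconj (m22 A) * (m22 A * z) = qconj (m12 A) * (m12 A * z) + z" for z
    by (simp_all add: mult.assoc[symmetric] distrib_right)
  then show ?thesis
    by (simp add: algebra_simps)
qed

text \<open>With \<open>v_p = (p, 1)\<close> and the form of signature (1,1), \<open>outer p d q\<close> is the rank-one matrix
  \<open>v_p d v_q^*\<close> and \<open>frm p A q\<close> is \<open>v_p^* A v_q\<close>, where \<open>v^*\<close> is the adjoint with respect to the form.\<close>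

definition outer :: "quat \<Rightarrow> quat \<Rightarrow> quat \<Rightarrow> mat2" where
  "outer p d q = M2 (- (p * d * qconj q)) (p * d) (- (d * qconj q)) d"

definition frm :: "quat \<Rightarrow> mat2 \<Rightarrow> quat \<Rightarrow> quat" where
  "frm p A q = m21 A * q + m22 A - qconj p * (m11 A * q + m12 A)"

lemma outer_sel [simp]:
  "m11 (outer p d q) = - (p * d * qconj q)" "m12 (outer p d q) = p * d"
  "m21 (outer p d q) = - (d * qconj q)" "m22 (outer p d q) = d"
  by (simp_all add: outer_def)

lemma frm_one: "frm p 1 q = 1 - qconj p * q"
  by (simp add: frm_def)

text \<open>Distinct null lines are never orthogonal. This keeps the factors nonzero that arise in
  products of rank-one matrices.\<close>

lemma frm_one_eq_0_iff: "norm p = 1 \<Longrightarrow> frm p 1 q = 0 \<longleftrightarrow> q = p"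
  by (metis eq_iff_diff_eq_0 frm_one mult_1_right unit_qconj)

lemma outer_mult_mult_outer: "outer p d q * A * outer p' d' q' = outer p (d * frm q A p' * d') q'"
  by (simp add: mat2_eq_iff frm_def algebra_simps)

lemma outer_mult_outer: "outer p d q * outer p' d' q' = outer p (d * (1 - qconj q * p') * d') q'"
  using outer_mult_mult_outer[of p d q 1] by (simp add: frm_one)

lemma adj_outer: "adj (outer p d q) = outer q (qconj d) p"
  by (simp add: mat2_eq_iff mult.assoc)

lemma mtrace_outer: "mtrace (outer p d q) = d - p * d * qconj q"
  by (simp add: mtrace_def)

lemma outer_add: "outer p (d + e) q = outer p d q + outer p e q"
  by (simp add: mat2_eq_iff algebra_simps)

lemma outer_scaleR: "outer p (r *\<^sub>R d) q = r *\<^sub>R outer p d q"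
  by (simp add: mat2_eq_iff)

lemma mult_outer:
  assumes "m11 A * p + m12 A = p' * l" "m21 A * p + m22 A = l"
  shows "A * outer p d q = outer p' (l * d) q"
proof -
  have d: "m11 A * p * z + m12 A * z = p' * l * z" "m21 A * p * z + m22 A * z = l * z" for z
    using assms by (simp_all add: distrib_right[symmetric])
  have "- (m11 A * p * (d * qconj q) + m12 A * (d * qconj q)) = - (p' * l * (d * qconj q))"
    "- (m21 A * p * (d * qconj q) + m22 A * (d * qconj q)) = - (l * (d * qconj q))"
    unfolding d by simp_all
  with d[of d] show ?thesis
    by (simp add: mat2_eq_iff mult.assoc)
qed

text \<open>The vector \<open>A v_p\<close> is nonzero, and null because the form is preserved.
  Hence it is \<open>v_p' l\<close> for a boundary point \<open>p'\<close>, with multiplier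
  \<open>l\<close>.\<close>

lemma Sp11_action:
  assumes "A \<in> Sp11" "norm p = 1"
  obtains p' l where "norm p' = 1" "l \<noteq> 0" "m11 A * p + m12 A = p' * l" "m21 A * p + m22 A = l"
proof -
  define l m where "l = m21 A * p + m22 A" and "m = m11 A * p + m12 A"
  have "qconj l * l - qconj m * m = 0"
    using Sp11_form_invariant[OF assms(1), of p 1 p 1] assms(2) by (simp add: l_def m_def unit_qconj)
  then have "of_real ((norm l)\<^sup>2) = (of_real ((norm m)\<^sup>2) :: quat)"
    by (simp add: mult_qconj)
  then have nm: "norm l = norm m"
    by (simp only: of_real_eq_iff) simp
  have l0: "l \<noteq> 0"
  proof
    assume l: "l = 0"
    then have m: "m = 0" using nm by simp
    \<comment> \<open>The vectors \<open>v_p\<close> and \<open>(0, 1)\<close> pair to 1, hence so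
      do their images, and \<open>A v_p\<close> cannot be zero.\<close>
    show False
      using Sp11_form_invariant[OF assms(1), of p 1 0 1]
      unfolding mult_1_right l_def[symmetric] m_def[symmetric] l m by simp
  qed
  show ?thesis
  proof
    show "norm (m * inverse l) = 1"
      using l0 by (simp add: norm_mult norm_inverse nm[symmetric])
    show "m11 A * p + m12 A = m * inverse l * l"
      using l0 by (simp add: mult.assoc m_def)
  qed (use l0 l_def in auto)
qed

text \<open>This is how group elements permute the rank-one elements. Right multiplication by
  \<open>adj A\<close> is reduced to left multiplication by taking adjoints.\<close>

lemma outer_conjugate:
  assumes "m11 A * p + m12 A = p' * l" "m21 A * p + m22 A = l"
  shows "A * outer p d p * adj A = outer p' (l * d * qconj l) p'"
proof -
  have "A * outer p (qconj d * qconj l) p' = outer p' (l * qconj d * qconj l) p'"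
    using mult_outer[OF assms] by (simp add: mult.assoc)
  moreover have "A * outer p d p * adj A = outer p' (l * d) p * adj A"
    using mult_outer[OF assms] by simp
  moreover have "outer p' (l * d) p * adj A = adj (A * outer p (qconj d * qconj l) p')"
    by (simp add: adj_mult adj_outer)
  ultimately show ?thesis
    by (simp add: adj_outer mult.assoc)
qed

text \<open>The double annihilator of \<open>G\<close> under the pairing \<open>Re tr (M X)\<close>. It is the real span of \<open>G\<close>, described in
  such a way that closedness under limits is immediate.\<close>

definition trace_hull :: "mat2 set \<Rightarrow> mat2 set" where
  "trace_hull G = {X. \<forall>M. (\<forall>A\<in>G. qre (mtrace (M * A)) = 0) \<longrightarrow> qre (mtrace (M * X)) = 0}"

lemma trace_hull_base: "A \<in> G \<Longrightarrow> A \<in> trace_hull G"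
  by (simp add: trace_hull_def)

lemma trace_hull_add: "X \<in> trace_hull G \<Longrightarrow> Y \<in> trace_hull G \<Longrightarrow> X + Y \<in> trace_hull G"
  by (simp add: trace_hull_def distrib_left)

lemma trace_hull_scaleR: "X \<in> trace_hull G \<Longrightarrow> r *\<^sub>R X \<in> trace_hull G"
  by (simp add: trace_hull_def)

section \<open>Closure of the double annihilator under products and adjoints\<close>

locale Sp11_subgroup =
  fixes G :: "mat2 set"
  assumes Sp11: "A \<in> G \<Longrightarrow> A \<in> Sp11"
    and one_closed: "1 \<in> G"
    and mult_closed: "A \<in> G \<Longrightarrow> B \<in> G \<Longrightarrow> A * B \<in> G"
    and adj_closed: "A \<in> G \<Longrightarrow> adj A \<in> G"
begin

text \<open>The factors are replaced one at a time. For \<open>A\<close> in \<open>G\<close>,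
  \<open>M * A\<close> annihilates \<open>G\<close> and hence \<open>Y\<close>; by cyclicity of the
  real trace \<open>Y * M\<close> then annihilates \<open>G\<close> and hence
  \<open>X\<close>.\<close>

lemma trace_hull_mult:
  assumes "X \<in> trace_hull G" "Y \<in> trace_hull G"
  shows "X * Y \<in> trace_hull G"
  unfolding trace_hull_def mem_Collect_eq
proof (intro allI impI)
  fix M assume M: "\<forall>A\<in>G. qre (mtrace (M * A)) = 0"
  have "qre (mtrace (Y * M * A)) = 0" if "A \<in> G" for A
  proof -
    have "\<forall>B\<in>G. qre (mtrace (M * A * B)) = 0"
      using M mult_closed[OF that] by (simp add: mult.assoc)
    then have "qre (mtrace (M * A * Y)) = 0"
      using assms(2) by (simp add: trace_hull_def)
    then show ?thesis
      using qre_mtrace_commute[of "M * A" Y] by (simp add: mult.assoc)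
  qed
  then have "qre (mtrace (Y * M * X)) = 0"
    using assms(1) by (simp add: trace_hull_def)
  then show "qre (mtrace (M * (X * Y))) = 0"
    using qre_mtrace_commute[of Y "M * X"] by (simp add: mult.assoc)
qed

lemma trace_hull_adj:
  assumes "X \<in> trace_hull G"
  shows "adj X \<in> trace_hull G"
  unfolding trace_hull_def mem_Collect_eq
proof (intro allI impI)
  have *: "qre (mtrace (adj M * A)) = qre (mtrace (M * adj A))" for M A
    using qre_mtrace_adj[of "adj M * A"] by (simp add: adj_mult qre_mtrace_commute)
  fix M assume M: "\<forall>A\<in>G. qre (mtrace (M * A)) = 0"
  then have "\<forall>A\<in>G. qre (mtrace (adj M * A)) = 0"
    using * adj_closed by simp
  then have "qre (mtrace (adj M * X)) = 0"
    using assms unfolding trace_hull_def by blast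
  then show "qre (mtrace (M * adj X)) = 0"
    by (simp only: *)
qed

end

section \<open>Rank-one elements of the hull under real traces\<close>

locale real_trace_group = Sp11_subgroup +
  assumes trace_real: "A \<in> G \<Longrightarrow> mtrace A \<in> \<real>"
begin

text \<open>The annihilator condition only controls real parts, so it is tested on scalar matrices
  \<open>mscal u\<close> with \<open>u\<close> imaginary: taking \<open>u\<close> to be each of the
  three units kills the imaginary components of the trace.\<close>

lemma trace_hull_trace_real:
  assumes "X \<in> trace_hull G"
  shows "mtrace X \<in> \<real>"
proof -
  have *: "qre (u * mtrace X) = 0" if "qre u = 0" for u
  proof -
    have tr: "qre (mtrace (mscal u * A)) = qre (u * mtrace A)" for A
      by (simp add: mtrace_def mscal_def algebra_simps)
    have "qre (u * mtrace A) = 0" if "A \<in> G" for A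
      using trace_real[OF that] \<open>qre u = 0\<close> by (auto simp: Reals_def quat_sel_mult)
    then have "\<forall>A\<in>G. qre (mtrace (mscal u * A)) = 0"
      by (simp only: tr) simp
    then have "qre (mtrace (mscal u * X)) = 0"
      using assms unfolding trace_hull_def by blast
    then show ?thesis
      by (simp only: tr)
  qed
  from *[of "Quat 0 1 0 0"] *[of "Quat 0 0 1 0"] *[of "Quat 0 0 0 1"]
  have "mtrace X = of_real (qre (mtrace X))"
    by (simp add: quat_eq_iff quat_sel_mult)
  then show ?thesis
    by (metis Reals_of_real)
qed

text \<open>The trace is \<open>d - p * d * qconj p\<close>. Conjugation by a unit preserves real
  parts, so this real number has real part 0 and vanishes.\<close>

lemma outer_commute:
  assumes "norm p = 1" "outer p d p \<in> trace_hull G"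
  shows "p * d = d * p"
proof -
  have "d - p * d * qconj p \<in> \<real>"
    using trace_hull_trace_real[OF assms(2)] by (simp add: mtrace_outer)
  then obtain t where t: "d - p * d * qconj p = of_real t"
    by (auto simp: Reals_def)
  have "qre (p * d * qconj p) = qre (qconj p * (p * d))"
    by (rule qre_mult_commute)
  then have "qre (d - p * d * qconj p) = 0"
    using assms(1) by (simp add: unit_qconj)
  then have "t = 0"
    by (simp add: t)
  then have "d = p * d * qconj p"
    using t by simp
  then show ?thesis
    by (metis assms(1) mult.assoc mult_1_right unit_qconj(2))
qed

text \<open>The trace of the product is \<open>2 - (qconj p * q + p * qconj q)\<close>. Up to a
  factor, its imaginary part is the cross product of the imaginary parts of \<open>p\<close> and
  \<open>q\<close>.\<close>

lemma pole_commute: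
  assumes "norm p = 1" "norm q = 1" "outer p 1 p \<in> trace_hull G" "outer q 1 q \<in> trace_hull G"
  shows "p * q = q * p"
proof -
  have "outer p 1 p * outer q 1 q \<in> trace_hull G"
    using assms trace_hull_mult by blast
  from trace_hull_trace_real[OF this]
  have "1 - qconj p * q - p * (1 - qconj p * q) * qconj q \<in> \<real>"
    by (simp add: outer_mult_outer mtrace_outer)
  also have "1 - qconj p * q - p * (1 - qconj p * q) * qconj q = 2 - (qconj p * q + p * qconj q)"
    using assms by (simp add: algebra_simps unit_qconj)
  finally have "qconj (2 - (qconj p * q + p * qconj q)) = 2 - (qconj p * q + p * qconj q)"
    by (simp only: qconj_real_iff)
  then show ?thesis
    by (simp add: quat_eq_iff quat_sel_mult algebra_simps)
qed

text \<open>The three points commute pairwise, so one can compute as with complex numbers. The trace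
  of the triple product is then the cyclic product \<open>z\<close>, which is real, purely imaginary
  and nonzero at once.\<close>

lemma pole_triple:
  assumes "norm p = 1" "norm q = 1" "norm r = 1" "p \<noteq> q" "q \<noteq> r" "p \<noteq> r"
    and "outer p 1 p \<in> trace_hull G" "outer q 1 q \<in> trace_hull G" "outer r 1 r \<in> trace_hull G"
  shows False
proof -
  have c: "p * q = q * p" "p * r = r * p" "q * r = r * q"
    using pole_commute assms by auto
  have cc: "qconj y * x = x * qconj y" if "x * y = y * x" "norm y = 1" for x y
    using that by (metis mult.assoc mult_1_right unit_qconj(1,2) mult_1)
  have comm: "x * y = y * x" "x * (y * t) = y * (x * t)" "x * qconj y = qconj y * x"
      "x * (qconj y * t) = qconj y * (x * t)" "qconj x * y = y * qconj x"
      "qconj x * (y * t) = y * (qconj x * t)" "qconj x * qconj y = qconj y * qconj x"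
      "qconj x * (qconj y * t) = qconj y * (qconj x * t)"
    if "x * y = y * x" "norm x = 1" "norm y = 1" for x y t
  proof -
    show *: "x * y = y * x" "x * qconj y = qconj y * x" "qconj x * y = y * qconj x"
      "qconj x * qconj y = qconj y * qconj x"
      using that cc[of x y] cc[of y x] qconj_mult[of x y] qconj_mult[of y x] by metis+
    show "x * (y * t) = y * (x * t)" "x * (qconj y * t) = qconj y * (x * t)"
      "qconj x * (y * t) = y * (qconj x * t)" "qconj x * (qconj y * t) = qconj y * (qconj x * t)"
      by (simp_all add: mult.assoc[symmetric] *)
  qed
  note rules = comm[OF c(1)[symmetric] assms(2,1)] comm[OF c(2)[symmetric] assms(3,1)]
    comm[OF c(3)[symmetric] assms(3,2)] unit_qconj[OF assms(1)] unit_qconj[OF assms(2)] unit_qconj[OF assms(3)]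
  define z where "z = (1 - qconj p * q) * (1 - qconj q * r) * (1 - qconj r * p)"
  have z0: "z \<noteq> 0"
    using assms frm_one_eq_0_iff by (simp add: z_def frm_one[symmetric])
  have "outer p 1 p * outer q 1 q * outer r 1 r \<in> trace_hull G"
    using assms trace_hull_mult by blast
  from trace_hull_trace_real[OF this]
  have "(1 - qconj p * q) * (1 - qconj q * r) - p * ((1 - qconj p * q) * (1 - qconj q * r)) * qconj r \<in> \<real>"
    by (simp add: outer_mult_outer mtrace_outer mult.assoc)
  moreover have "p * ((1 - qconj p * q) * (1 - qconj q * r)) * qconj r
     = (1 - qconj p * q) * (1 - qconj q * r) * (qconj r * p)"
    by (simp add: algebra_simps rules)
  ultimately have "z \<in> \<real>"
    by (simp add: z_def right_diff_distrib)
  \<comment> \<open>each factor satisfies \<open>1 - q^* p = - (q^* p) (1 - p^* q)\<close>, and the three unit factors cancel\<close>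
  moreover have "qconj z = - z"
    by (simp add: z_def algebra_simps rules)
  ultimately show False
    using z0 qconj_real_iff[of z] by (simp add: quat_eq_iff)
qed

end

lemma Reals_scaleR: "x \<in> \<real> \<Longrightarrow> r *\<^sub>R x \<in> \<real>" for x :: "'a::real_algebra_1"
  by (simp add: scaleR_conv_of_real)

context real_trace_group
begin

text \<open>An algebraic substitute for limit points: the arguments on the hull use only these
  rank-one elements, and limit points of a discrete nonelementary group are later shown to be
  poles.\<close>

definition poles :: "quat set" where
  "poles = {p. norm p = 1 \<and> (\<exists>d. d \<noteq> 0 \<and> outer p d p \<in> trace_hull G)}"

text \<open>If \<open>d\<close> has nonzero real part, adding the adjoint produces the coefficient 1
  at \<open>s\<close>. Sandwiching \<open>outer s 1 s\<close> between a rank-one element at another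
  pole and its adjoint gives a positive real coefficient there. So all poles get coefficient 1,
  against \<open>pole_triple\<close>.\<close>

lemma outer_imaginary:
  assumes "p \<in> poles" "q \<in> poles" "r \<in> poles" "p \<noteq> q" "q \<noteq> r" "p \<noteq> r"
    and s: "norm s = 1" "outer s d s \<in> trace_hull G"
  shows "qconj d = - d"
proof (rule ccontr)
  assume "qconj d \<noteq> - d"
  then have ne: "d + qconj d \<noteq> 0"
    by (simp add: eq_neg_iff_add_eq_0 add.commute)
  have "d + qconj d = of_real (2 * qre d)"
    by (simp add: quat_eq_iff del: of_real_mult)
  moreover have "outer s (d + qconj d) s \<in> trace_hull G"
    using s(2) trace_hull_adj[OF s(2)] by (simp add: outer_add adj_outer trace_hull_add)
  ultimately have "outer s ((2 * qre d) *\<^sub>R 1) s \<in> trace_hull G" "2 * qre d \<noteq> 0"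
    using ne by (simp_all add: of_real_def)
  then have Ns: "outer s 1 s \<in> trace_hull G"
    using trace_hull_scaleR[of "outer s ((2 * qre d) *\<^sub>R 1) s" G "inverse (2 * qre d)"]
    by (simp add: outer_scaleR)
  have N: "outer x 1 x \<in> trace_hull G" if x: "x \<in> poles" for x
  proof (cases "x = s")
    case True
    then show ?thesis using Ns by simp
  next
    case False
    obtain e where e: "e \<noteq> 0" "outer x e x \<in> trace_hull G" and nx: "norm x = 1"
      using x by (auto simp: poles_def)
    define w where "w = 1 - qconj x * s"
    have w0: "w \<noteq> 0"
      using frm_one_eq_0_iff[OF nx, of s] False by (simp add: w_def frm_one)
    have "outer x e x * outer s 1 s * outer x (qconj e) x \<in> trace_hull G"
      using e(2) Ns trace_hull_adj[OF e(2)] by (simp add: adj_outer trace_hull_mult)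
    moreover have "outer x e x * outer s 1 s * outer x (qconj e) x = outer x ((e * w) * qconj (e * w)) x"
      by (simp add: outer_mult_outer w_def mult.assoc)
    ultimately have "((norm (e * w))\<^sup>2) *\<^sub>R outer x 1 x \<in> trace_hull G"
      by (simp only: mult_qconj outer_scaleR[symmetric]) (simp only: of_real_def)
    from trace_hull_scaleR[OF this, of "inverse ((norm (e * w))\<^sup>2)"]
    show ?thesis
      using e(1) w0 by simp
  qed
  show False
    using pole_triple[of p q r] N assms(1-6) by (simp add: poles_def)
qed

text \<open>Here \<open>p\<close> lies in \<open>\<real>[d]\<close> and \<open>q\<close> in
  \<open>\<real>[e]\<close>. Reality of the trace of the product of the two rank-one elements forces
  \<open>d * e\<close> to be real, and multiplying by \<open>d\<close> again exhibits
  \<open>e\<close> as a real multiple of \<open>d\<close>.\<close>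

lemma outer_parallel:
  assumes "norm p = 1" "norm q = 1" "d \<noteq> 0" "e \<noteq> 0" "qconj d = - d" "qconj e = - e"
    and "outer p d p \<in> trace_hull G" "outer q e q \<in> trace_hull G" "p \<notin> \<real>"
  obtains r where "e = r *\<^sub>R d"
proof -
  have pd: "p * d = d * p" and qe: "q * e = e * q"
    using outer_commute assms by auto
  obtain a x where p: "p = of_real a + x *\<^sub>R d"
    using imaginary_commute_scaleR[OF assms(5,3) pd] .
  obtain c y where q: "q = of_real c + y *\<^sub>R e"
    using imaginary_commute_scaleR[OF assms(6,4) qe] .
  have x0: "x \<noteq> 0"
    using p assms(9) by auto
  have d0: "qre d = 0" "qre e = 0"
    using assms(5,6) by (simp_all add: quat_eq_iff)
  have dd: "d * d = - of_real ((norm d)\<^sup>2)" and ee: "e * e = - of_real ((norm e)\<^sup>2)"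
    using arg_cong[OF mult_qconj(1)[of d], of uminus] arg_cong[OF mult_qconj(1)[of e], of uminus] assms(5,6)
    by simp_all
  have np: "a\<^sup>2 + x\<^sup>2 * (norm d)\<^sup>2 = 1" and nq: "c\<^sup>2 + y\<^sup>2 * (norm e)\<^sup>2 = 1"
    using norm_quat_square[of p] norm_quat_square[of q] norm_quat_square[of d] norm_quat_square[of e]
      assms(1,2) d0 by (simp_all add: p q algebra_simps power_mult_distrib)
  \<comment> \<open>Since \<open>p\<close> is not real, its real part satisfies
    \<open>a\<^sup>2 < 1\<close>, whereas \<open>q\<close> may be real; this suffices for
    \<open>a * c \<noteq> 1\<close>.\<close>
  have "0 < x\<^sup>2 * (norm d)\<^sup>2"
    using x0 assms(3) by simp
  then have "a\<^sup>2 < 1"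
    using np by linarith
  moreover have "0 \<le> y\<^sup>2 * (norm e)\<^sup>2"
    by simp
  then have "c\<^sup>2 \<le> 1"
    using nq by linarith
  ultimately have "a\<^sup>2 * c\<^sup>2 < 1"
    by (smt (verit, ccfv_SIG) mult_left_le zero_le_power2)
  then have ac: "2 - 2 * a * c \<noteq> 0"
    by (auto simp: power_mult_distrib[symmetric])
  have "outer p d p * outer q e q \<in> trace_hull G"
    using assms trace_hull_mult by blast
  from trace_hull_trace_real[OF this]
  have tr: "d * (1 - qconj p * q) * e - p * (d * (1 - qconj p * q) * e) * qconj q \<in> \<real>"
    by (simp add: outer_mult_outer mtrace_outer)
  have eq: "p * (d * (1 - qconj p * q) * e) * qconj q = d * (p * qconj q - 1) * e"
  proof -
    have "e * qconj q = qconj q * e"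
      using qe assms(6) qconj_mult[of e q] qconj_mult[of q e] by simp
    then have "p * (d * (1 - qconj p * q) * e) * qconj q = d * (p * (1 - qconj p * q) * qconj q) * e"
      using pd by (simp add: mult.assoc) (simp add: mult.assoc[symmetric])
    also have "p * (1 - qconj p * q) * qconj q = p * qconj q - 1"
      using assms(1,2) by (simp add: algebra_simps unit_qconj)
    finally show ?thesis .
  qed
  \<comment> \<open>with \<open>p = a + x d\<close> and \<open>q = c + y e\<close> this trace is \<open>(2 - 2 a c) d e + 2 x y d\<^sup>2 e\<^sup>2\<close>, where the second
    summand is real and \<open>\<bar>a c\<bar> < 1\<close>\<close>
  have "d * e + d * e - d * (qconj p * q + p * qconj q) * e
      = d * (1 - qconj p * q) * e - d * (p * qconj q - 1) * e"
    by (simp add: algebra_simps)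
  also have "\<dots> \<in> \<real>"
    using tr by (simp only: eq)
  finally have "d * e + d * e - d * (qconj p * q + p * qconj q) * e \<in> \<real>" .
  moreover have "qconj p * q + p * qconj q = (2 * a * c) *\<^sub>R 1 - (2 * x * y) *\<^sub>R (d * e)"
    using assms(5,6) by (simp add: p q of_real_def algebra_simps)
      (simp only: mult_2_right distrib_left scaleR_add_left ac_simps)
  moreover have "d * e + d * e - d * ((2 * a * c) *\<^sub>R 1 - (2 * x * y) *\<^sub>R (d * e)) * e
      = (2 - 2 * a * c) *\<^sub>R (d * e) + (2 * x * y) *\<^sub>R ((d * d) * (e * e))"
    by (simp add: algebra_simps scaleR_2)
  ultimately have "(2 - 2 * a * c) *\<^sub>R (d * e) + (2 * x * y) *\<^sub>R ((d * d) * (e * e)) \<in> \<real>"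
    by (simp only:)
  moreover have "(2 * x * y) *\<^sub>R ((d * d) * (e * e)) \<in> \<real>"
    by (simp add: dd ee scaleR_conv_of_real)
  ultimately have "(2 - 2 * a * c) *\<^sub>R (d * e) \<in> \<real>"
    using Reals_diff by fastforce
  then have "inverse (2 - 2 * a * c) *\<^sub>R ((2 - 2 * a * c) *\<^sub>R (d * e)) \<in> \<real>"
    by (rule Reals_scaleR)
  then have "d * e \<in> \<real>"
    using ac by simp
  then obtain s where s: "d * e = of_real s"
    by (auto simp: Reals_def)
  have "d * (d * e) = (- (norm d)\<^sup>2) *\<^sub>R e"
    by (simp add: mult.assoc[symmetric] dd scaleR_conv_of_real)
  moreover have "d * (d * e) = s *\<^sub>R d"
    by (simp add: s of_real_def)
  ultimately have "inverse (- (norm d)\<^sup>2) *\<^sub>R ((- (norm d)\<^sup>2) *\<^sub>R e) = inverse (- (norm d)\<^sup>2) *\<^sub>R (s *\<^sub>R d)"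
    by (simp only:)
  then have "e = (inverse (- (norm d)\<^sup>2) * s) *\<^sub>R d"
    using assms(3) by simp
  then show ?thesis by (rule that)
qed

end

section \<open>Algebra relative to an imaginary axis \<open>u\<close>\<close>

lemma commute_via_imaginary:
  assumes "qconj u = - u" "u \<noteq> 0" "x * u = u * x" "y * u = u * y"
  shows "x * y = y * x"
proof -
  obtain a b c d where "x = of_real a + b *\<^sub>R u" "y = of_real c + d *\<^sub>R u"
    using imaginary_commute_scaleR[OF assms(1,2)] assms(3,4) by metis
  then show ?thesis
    by (simp add: of_real_def algebra_simps)
qed

lemma commute_qconj:
  assumes "qconj u = - u" "x * u = u * x"
  shows "qconj x * u = u * qconj x"
  using assms qconj_mult[of x u] qconj_mult[of u x] by simp

text \<open>An element anticommuting with \<open>u\<close> induces complex conjugation on the plane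
  \<open>\<real>[u]\<close>.\<close>

lemma anticommute_swap:
  assumes "qconj u = - u" "u \<noteq> 0" "s * u = u * s" "l * u = - u * l"
  shows "s * l = l * qconj s"
proof -
  obtain a b where "s = of_real a + b *\<^sub>R u"
    using imaginary_commute_scaleR[OF assms(1,2,3)] .
  then show ?thesis
    using assms(1,4) by (simp add: of_real_def algebra_simps)
qed

text \<open>An intertwining relation that holds at two values of an affine expression passes to both
  coefficients, by subtracting and cancelling \<open>s1 - s2\<close>.\<close>

lemma intertwining_coeffs:
  fixes c d u v s1 s2 :: quat
  assumes "s1 \<noteq> s2" "s1 * u = u * s1" "s2 * u = u * s2"
    and "(c * s1 + d) * u = v * (c * s1 + d)" "(c * s2 + d) * u = v * (c * s2 + d)"
  shows "c * u = v * c" "d * u = v * d"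
proof -
  have "(c * u - v * c) * (s1 - s2) = ((c * s1 + d) * u - v * (c * s1 + d)) - ((c * s2 + d) * u - v * (c * s2 + d))"
    using assms(2,3) by (simp add: algebra_simps)
  then show c: "c * u = v * c"
    using assms(1,4,5) by simp
  have "d * u - v * d = ((c * s1 + d) * u - v * (c * s1 + d)) - (c * u - v * c) * s1"
    using assms(2) by (simp add: algebra_simps)
  then show "d * u = v * d"
    using assms(4) c by simp
qed

text \<open>Commuting roots allow the usual divided differences: cancelling \<open>s1 - s2\<close>
  and \<open>s1 - s3\<close> on the right leaves linear relations, whose difference gives
  \<open>c = 0\<close>.\<close>

lemma quadratic_three_roots:
  fixes c e f s1 s2 s3 :: quat
  assumes "s1 \<noteq> s2" "s2 \<noteq> s3" "s1 \<noteq> s3" "s1 * s2 = s2 * s1" "s1 * s3 = s3 * s1"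
    and "c * s1 * s1 + e * s1 + f = 0" "c * s2 * s2 + e * s2 + f = 0" "c * s3 * s3 + e * s3 + f = 0"
  shows "c = 0 \<and> e = 0 \<and> f = 0"
proof -
  have "(c * (s1 + s2) + e) * (s1 - s2) = (c * s1 * s1 + e * s1 + f) - (c * s2 * s2 + e * s2 + f)"
    "(c * (s1 + s3) + e) * (s1 - s3) = (c * s1 * s1 + e * s1 + f) - (c * s3 * s3 + e * s3 + f)"
    using assms(4,5) by (simp_all add: algebra_simps)
  then have 1: "c * (s1 + s2) + e = 0" "c * (s1 + s3) + e = 0"
    using assms(1,3,6-8) by auto
  have "c * (s2 - s3) = (c * (s1 + s2) + e) - (c * (s1 + s3) + e)"
    by (simp add: algebra_simps)
  then have "c * (s2 - s3) = 0"
    by (simp only: 1 diff_self)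
  then show ?thesis
    using 1 assms(2,6) by simp
qed

section \<open>The common axis and the shape of the group elements\<close>

context real_trace_group
begin

lemma common_axis:
  assumes "p \<in> poles" "q \<in> poles" "r \<in> poles" "p \<noteq> q" "q \<noteq> r" "p \<noteq> r"
  obtains u where "u \<noteq> 0" "qconj u = - u"
    and "\<forall>s e. norm s = 1 \<longrightarrow> outer s e s \<in> trace_hull G \<longrightarrow> (\<exists>t. e = t *\<^sub>R u)"
    and "\<forall>s\<in>poles. s * u = u * s \<and> outer s u s \<in> trace_hull G"
proof -
  \<comment> \<open>Only two unit quaternions are real, so one of three distinct poles is not. Its
    coefficient serves as the axis \<open>u\<close>, as \<open>outer_parallel\<close> requires a
    non-real point.\<close>
  have "x = 1 \<or> x = -1" if "x \<in> \<real>" "norm x = 1" for x :: quat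
    using that by (auto simp: Reals_def abs_if split: if_splits)
  then obtain g where g: "g \<in> poles" "g \<notin> \<real>"
    using assms by (auto simp: poles_def) metis
  then obtain u where u: "norm g = 1" "u \<noteq> 0" "outer g u g \<in> trace_hull G"
    by (auto simp: poles_def)
  have im: "qconj u = - u"
    using outer_imaginary[OF assms] u by blast
  have par: "\<exists>t. e = t *\<^sub>R u" if s: "norm s = 1" "outer s e s \<in> trace_hull G" for s e
  proof (cases "e = 0")
    case False
    have "qconj e = - e"
      using outer_imaginary[OF assms] s by blast
    then show ?thesis
      using outer_parallel[OF u(1) s(1) u(2) False im _ u(3) s(2) g(2)] by blast
  qed (auto intro!: exI[of _ 0])
  have "s * u = u * s \<and> outer s u s \<in> trace_hull G" if s: "s \<in> poles" for s
  proof -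
    obtain e where e: "norm s = 1" "e \<noteq> 0" "outer s e s \<in> trace_hull G"
      using s by (auto simp: poles_def)
    then obtain t where t: "e = t *\<^sub>R u" using par by blast
    then have "outer s u s = inverse t *\<^sub>R outer s e s"
      using e(2) by (simp add: outer_scaleR)
    then have "outer s u s \<in> trace_hull G"
      using e(3) trace_hull_scaleR by simp
    then show ?thesis
      using outer_commute[OF e(1)] by simp
  qed
  then show ?thesis
    using that u(2) im par by blast
qed

text \<open>Each multiplier of \<open>A\<close> at a pole commutes or anticommutes with
  \<open>u\<close>. Two of three poles share the sign, which therefore passes to the entries of
  \<open>A\<close>. The minus sign is refuted; in the other case the real traces of
  \<open>A * outer s u s\<close> at three poles determine the shape of \<open>A\<close>.\<close>

lemma common_complex_line:
  assumes "p \<in> poles" "q \<in> poles" "r \<in> poles" "p \<noteq> q" "q \<noteq> r" "p \<noteq> r"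
  obtains u where "u \<noteq> 0" "qconj u = - u"
    and "\<And>A. A \<in> G \<Longrightarrow> m11 A * u = u * m11 A \<and> m12 A * u = u * m12 A
           \<and> m21 A = qconj (m12 A) \<and> m22 A = qconj (m11 A)"
proof -
  obtain u where u: "u \<noteq> 0" "qconj u = - u"
    and par: "\<forall>s e. norm s = 1 \<longrightarrow> outer s e s \<in> trace_hull G \<longrightarrow> (\<exists>t. e = t *\<^sub>R u)"
    and pole_all: "\<forall>s\<in>poles. s * u = u * s \<and> outer s u s \<in> trace_hull G"
    using common_axis[OF assms] by metis
  have pole: "s * u = u * s \<and> outer s u s \<in> trace_hull G" if "s \<in> poles" for s
    using pole_all that by blast
  have pq: "p * q = q * p" and pr: "p * r = r * p"
    using commute_via_imaginary[OF u(2,1) conjunct1[OF pole[OF assms(1)]]] assms(2,3)[THEN pole, THEN conjunct1]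
    by blast+
  have "m11 A * u = u * m11 A \<and> m12 A * u = u * m12 A \<and> m21 A = qconj (m12 A) \<and> m22 A = qconj (m11 A)"
    if A: "A \<in> G" for A
  proof -
    let ?a = "m11 A" and ?b = "m12 A" and ?c = "m21 A" and ?d = "m22 A"
    \<comment> \<open>\<open>s'\<close> is the image pole, \<open>l\<close> the multiplier, and
      \<open>v\<close> records the sign. The last clause is reality of the trace of
      \<open>A * outer s u s\<close>.\<close>
    have act: "\<exists>s' l v. s' * u = u * s' \<and> norm s' = 1 \<and> l \<noteq> 0 \<and> ?a * s + ?b = s' * l \<and> ?c * s + ?d = l
         \<and> (v = u \<or> v = - u) \<and> l * u = v * l \<and> l * u - s' * (l * u) * qconj s \<in> \<real>"
      if s: "s \<in> poles" for s
    proof -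
      have ns: "norm s = 1" using s by (simp add: poles_def)
      obtain s' l where l: "norm s' = 1" "l \<noteq> 0" "?a * s + ?b = s' * l" "?c * s + ?d = l"
        using Sp11_action[OF Sp11[OF A] ns] .
      have o: "outer s' (l * u * qconj l) s' \<in> trace_hull G"
        using outer_conjugate[OF l(3,4), of u] pole[OF s] A adj_closed[OF A] trace_hull_base trace_hull_mult by metis
      then have s': "s' \<in> poles"
        using l(1,2) u(1) by (auto simp: poles_def intro!: exI[of _ "l * u * qconj l"])
      obtain t where t: "l * u * qconj l = t *\<^sub>R u"
        using par l(1) o by blast
      \<comment> \<open>Norms determine \<open>t\<close> up to sign; multiplying
        \<open>l * u * qconj l = t *\<^sub>R u\<close> by \<open>l\<close> on the right then gives
        commutation or anticommutation.\<close>
      have "(norm l)\<^sup>2 * norm u = \<bar>t\<bar> * norm u"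
        using arg_cong[OF t, of norm] by (simp add: norm_mult power2_eq_square mult_ac)
      then have "t = (norm l)\<^sup>2 \<or> t = - (norm l)\<^sup>2"
        using u(1) by auto
      moreover have "(norm l)\<^sup>2 *\<^sub>R (l * u) = t *\<^sub>R (u * l)"
      proof -
        have "l * u * (qconj l * l) = t *\<^sub>R u * l"
          using t by (simp add: mult.assoc[symmetric])
        then show ?thesis
          by (simp add: mult_qconj of_real_def del: of_real_power)
      qed
      ultimately have "(norm l)\<^sup>2 *\<^sub>R (l * u) = (norm l)\<^sup>2 *\<^sub>R (u * l)
          \<or> (norm l)\<^sup>2 *\<^sub>R (l * u) = (norm l)\<^sup>2 *\<^sub>R (- u * l)"
        by auto
      then have v: "l * u = u * l \<or> l * u = - u * l"
        using l(2) by (simp add: scaleR_left_imp_eq del: scaleR_minus_right)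
      have "A * outer s u s \<in> trace_hull G"
        using pole[OF s] A trace_hull_base trace_hull_mult by blast
      from trace_hull_trace_real[OF this] have "l * u - s' * (l * u) * qconj s \<in> \<real>"
        by (simp only: mult_outer[OF l(3,4)] mtrace_outer)
      then show ?thesis
        using pole[OF s'] l v by blast
    qed
    have mu: "(s' * l) * u = v * (s' * l)" if "s' * u = u * s'" "l * u = v * l" "v = u \<or> v = - u" for s' l v
      using that by (metis mult.assoc mult_minus_left mult_minus_right)
    obtain p' lp vp where P: "p' * u = u * p'" "norm p' = 1" "lp \<noteq> 0" "?a * p + ?b = p' * lp" "?c * p + ?d = lp"
        "vp = u \<or> vp = - u" "lp * u = vp * lp"
      using act[OF assms(1)] by blast
    obtain q' lq vq where Q: "q' * u = u * q'" "norm q' = 1" "lq \<noteq> 0" "?a * q + ?b = q' * lq" "?c * q + ?d = lq"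
        "vq = u \<or> vq = - u" "lq * u = vq * lq"
      using act[OF assms(2)] by blast
    obtain r' lr vr where R: "r' * u = u * r'" "norm r' = 1" "lr \<noteq> 0" "?a * r + ?b = r' * lr" "?c * r + ?d = lr"
        "vr = u \<or> vr = - u" "lr * u = vr * lr"
      using act[OF assms(3)] by blast
    have "\<exists>v. (v = u \<or> v = - u) \<and> ?a * u = v * ?a \<and> ?b * u = v * ?b \<and> ?c * u = v * ?c \<and> ?d * u = v * ?d"
    proof -
      have two: ?thesis if "s \<in> poles" "t \<in> poles" "s \<noteq> t" "v = u \<or> v = - u" "s' * u = u * s'" "t' * u = u * t'"
        "?a * s + ?b = s' * ls" "?c * s + ?d = ls" "?a * t + ?b = t' * lt" "?c * t + ?d = lt"
        "ls * u = v * ls" "lt * u = v * lt" for s t s' t' ls lt v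
        using intertwining_coeffs[of s t u ?a ?b v] intertwining_coeffs[of s t u ?c ?d v] that pole
          mu[of s' ls v] mu[of t' lt v] by metis
      have "vp = vq \<or> vq = vr \<or> vp = vr"
        using P(6) Q(6) R(6) by auto
      then show ?thesis
      proof (elim disjE)
        assume "vp = vq" then show ?thesis
          using two[OF assms(1,2,4) P(6) P(1) Q(1) P(4,5) Q(4,5)] P(7) Q(7) by simp
      next
        assume "vq = vr" then show ?thesis
          using two[OF assms(2,3,5) Q(6) Q(1) R(1) Q(4,5) R(4,5)] Q(7) R(7) by simp
      next
        assume "vp = vr" then show ?thesis
          using two[OF assms(1,3,6) P(6) P(1) R(1) P(4,5) R(4,5)] P(7) R(7) by simp
      qed
    qed
    then obtain v where v: "v = u \<or> v = - u" "?a * u = v * ?a" "?b * u = v * ?b" "?c * u = v * ?c" "?d * u = v * ?d"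
      by blast
    \<comment> \<open>In the anticommuting case \<open>A\<close> would send every pole
      \<open>s\<close> to \<open>qconj s\<close>. Three poles would then be roots of one quadratic,
      so \<open>A\<close> would be scalar with an entry anticommuting with \<open>u\<close>, while
      its real trace commutes with \<open>u\<close>.\<close>
    have vu: "v = u"
    proof (rule ccontr)
      assume "v \<noteq> u"
      then have vm: "v = - u" using v(1) by blast
      have quad: "?c * s * s + (?d - ?a) * s + (- ?b) = 0" if s: "s \<in> poles" for s
      proof -
        obtain s' l where l: "s' * u = u * s'" "norm s' = 1" "l \<noteq> 0" "?a * s + ?b = s' * l" "?c * s + ?d = l"
            "l * u - s' * (l * u) * qconj s \<in> \<real>"
          using act[OF s] by blast
        have su: "s * u = u * s" "norm s = 1" using pole[OF s] s by (auto simp: poles_def)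
        have lu: "l * u = - u * l"
          using v(4,5) vm su(1) by (simp add: l(5)[symmetric] algebra_simps) (simp add: mult.assoc[symmetric])
        have cl: "qconj s' * u = u * qconj s'" "qconj s * u = u * qconj s"
          using commute_qconj[OF u(2)] l(1) su(1) by auto
        \<comment> \<open>This is the real trace after \<open>s'\<close> has been moved past
          \<open>l * u\<close>, which conjugates it. Being real and anticommuting with
          \<open>u\<close>, it is 0.\<close>
        define X where "X = l * u * (1 - qconj s' * qconj s)"
        have "s' * (l * u) * qconj s = l * u * (qconj s' * qconj s)"
          using anticommute_swap[OF u(2,1) l(1) lu] cl by (metis mult.assoc)
        then have XR: "X \<in> \<real>"
          using l(6) by (simp only: X_def right_diff_distrib mult_1_right)
        have k: "(1 - qconj s' * qconj s) * u = u * (1 - qconj s' * qconj s)"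
          using cl by (simp only: left_diff_distrib right_diff_distrib mult_1_left mult_1_right) (metis mult.assoc)
        have "X * u = l * u * ((1 - qconj s' * qconj s) * u)"
          by (simp only: X_def mult.assoc)
        also have "\<dots> = l * u * u * (1 - qconj s' * qconj s)"
          by (simp only: k mult.assoc)
        also have "\<dots> = - u * X"
          by (subst lu) (simp only: X_def mult.assoc)
        finally have "X * u = - u * X" .
        then have "X * u = 0"
          using quat_real_commute[OF XR, of u] by (simp add: eq_neg_iff_add_eq_0 scaleR_2[symmetric])
        then have "qconj s' * qconj s = 1"
          using u(1) l(3) by (simp add: X_def)
        then have s'_eq: "s' = qconj s"
          using l(2) su(2) by (metis mult.assoc mult_1_right unit_qconj(2) qconj_simps(6) unit_qconj(1))
        have sc: "qconj s * x = x * s" if "x * u = - u * x" for x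
          using anticommute_swap[OF u(2,1) cl(2) that] by simp
        have "?a * s + ?b = qconj s * (?c * s + ?d)"
          using l(4,5) s'_eq by simp
        also have "\<dots> = ?c * s * s + ?d * s"
          using sc v(4,5) vm by (simp add: distrib_left mult.assoc[symmetric])
        finally show ?thesis
          by (simp add: algebra_simps)
      qed
      have z: "?c = 0 \<and> ?d - ?a = 0 \<and> - ?b = 0"
        using quadratic_three_roots[OF assms(4-6) pq pr] quad assms by blast
      then have "?a + ?a \<in> \<real>"
        using trace_real[OF A] by (simp add: mtrace_def)
      then have "(?a + ?a) * u = u * (?a + ?a)"
        by (rule quat_real_commute)
      then have "?a * u + ?a * u = u * ?a + u * ?a"
        by (simp add: algebra_simps)
      then have "u * ?a = 0"
        using v(2) vm by (simp add: quat_eq_iff)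
      then show False
        using u(1) z Sp11_norm(5)[OF Sp11[OF A]] by simp
    qed
    have ent: "?a * u = u * ?a" "?b * u = u * ?b" "?c * u = u * ?c" "?d * u = u * ?d"
      using v vu by auto
    define t where "t = ?d + qconj ?d - ?a - qconj ?a"
    have quad: "(?c - qconj ?b) * s * s + t * s + (qconj ?c - ?b) = 0" if s: "s \<in> poles" for s
    proof -
      obtain s' l where l: "s' * u = u * s'" "?a * s + ?b = s' * l" "?c * s + ?d = l"
          "l * u - s' * (l * u) * qconj s \<in> \<real>"
        using act[OF s] by blast
      have su: "s * u = u * s" "norm s = 1" using pole[OF s] s by (auto simp: poles_def)
      have cl: "qconj s * u = u * qconj s" "qconj ?b * u = u * qconj ?b" "qconj ?c * u = u * qconj ?c"
        using commute_qconj[OF u(2)] su(1) ent by auto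
      \<comment> \<open>The real trace equals \<open>y * u\<close>. As \<open>y\<close> commutes
        with the imaginary \<open>u\<close>, its real part vanishes; multiplying
        \<open>y + qconj y\<close> by \<open>s\<close> clears \<open>qconj s\<close> and leaves a
        quadratic in \<open>s\<close>.\<close>
      define y where "y = ?c * s + ?d - ?a - ?b * qconj s"
      have yu: "y * u = u * y"
        using ent su cl by (simp add: y_def algebra_simps) (simp add: mult.assoc[symmetric])
      have "l * u - s' * (l * u) * qconj s = l * u - (s' * l) * (u * qconj s)"
        by (simp add: mult.assoc)
      also have "\<dots> = (?c * s + ?d) * u - (?a * s + ?b) * (qconj s * u)"
        by (simp add: l(2,3) cl(1))
      also have "\<dots> = y * u"
        using su by (simp add: y_def algebra_simps unit_qconj)
      finally have conj: "qconj (y * u) = y * u"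
        using l(4) by (simp add: qconj_real_iff del: qconj_mult)
      have "- (u * qconj y) = u * y"
        using conj[unfolded qconj_mult u(2) mult_minus_left] by (simp only: yu)
      then have "u * (y + qconj y) = 0"
        by (simp add: distrib_left eq_neg_iff_add_eq_0 neg_eq_iff_add_eq_0 add.commute)
      then have 0: "(y + qconj y) * s = 0"
        using u(1) by simp
      have k: "qconj s * qconj ?c = qconj ?c * qconj s" "s * qconj ?b = qconj ?b * s"
        using commute_via_imaginary[OF u(2,1) cl(1) cl(3)] commute_via_imaginary[OF u(2,1) su(1) cl(2)] .
      have "(y + qconj y) * s = (?c - qconj ?b) * s * s + t * s + (qconj ?c - ?b)"
        using su(2) by (simp add: y_def t_def k algebra_simps unit_qconj)
      then show ?thesis
        using 0 by simp
    qed
    have "?c - qconj ?b = 0 \<and> t = 0 \<and> qconj ?c - ?b = 0"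
      using quadratic_three_roots[OF assms(4-6) pq pr] quad assms by blast
    then have c: "?c = qconj ?b" and t0: "t = 0" by auto
    \<comment> \<open>The real parts of the diagonal entries agree by \<open>t = 0\<close>, and the
      imaginary parts are opposite because the trace is real.\<close>
    have "qre ?d = qre ?a"
      using t0 by (simp add: t_def quat_eq_iff)
    moreover have "qconj (?a + ?d) = ?a + ?d"
      using trace_real[OF A] by (simp only: qconj_real_iff mtrace_def)
    ultimately have "?d = qconj ?a"
      by (auto simp: quat_eq_iff)
    then show ?thesis
      using ent c by blast
  qed
  then show ?thesis
    using that u by blast
qed

end

section \<open>Conjugation into SU(1,1)\<close>

text \<open>With \<open>n = norm u\<close>, the element \<open>g = n - u i\<close> satisfies
  \<open>u g = g (n i)\<close>. It vanishes only for \<open>u = - n i\<close>, where the unit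
  \<open>j\<close> works instead.\<close>

lemma imaginary_conjugate_to_i:
  assumes "qconj u = - u" "u \<noteq> 0"
  obtains h where "norm h = 1" "u * h = h * (norm u *\<^sub>R Quat 0 1 0 0)"
proof (cases "u = - (norm u *\<^sub>R Quat 0 1 0 0)")
  case True
  define n where "n = norm u"
  show ?thesis
  proof
    show "norm (Quat 0 0 1 0) = 1"
      by (simp add: norm_quat_def qnorm_def)
    have "u * Quat 0 0 1 0 = - (n *\<^sub>R Quat 0 1 0 0) * Quat 0 0 1 0"
      using True by (simp add: n_def)
    also have "\<dots> = Quat 0 0 1 0 * (n *\<^sub>R Quat 0 1 0 0)"
      by (simp add: quat_eq_iff quat_sel_mult)
    finally show "u * Quat 0 0 1 0 = Quat 0 0 1 0 * (norm u *\<^sub>R Quat 0 1 0 0)"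
      by (simp add: n_def)
  qed
next
  case False
  define i n where "i = Quat 0 1 0 0" and "n = norm u"
  have ii: "i * i = -1"
    by (simp add: i_def quat_eq_iff quat_sel_mult)
  have uu: "u * u = - (n\<^sup>2 *\<^sub>R 1)"
    using arg_cong[OF quat_mult_qconj(1)[of u], of uminus] assms(1) by (simp add: n_def)
  define g where "g = n *\<^sub>R 1 - u * i"
  have g0: "g \<noteq> 0"
  proof
    assume "g = 0"
    then have "u * i = n *\<^sub>R 1"
      by (simp add: g_def)
    then have "(u * i) * i = n *\<^sub>R i"
      by simp
    then have "- u = n *\<^sub>R i"
      by (simp add: mult.assoc ii)
    then show False
      using False unfolding n_def i_def by (metis minus_minus)
  qed
  have "u * g = n *\<^sub>R u - (u * u) * i"
    by (simp add: g_def right_diff_distrib mult.assoc)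
  also have "\<dots> = n *\<^sub>R u + n\<^sup>2 *\<^sub>R i"
    by (simp add: uu)
  also have "\<dots> = g * (n *\<^sub>R i)"
    by (simp add: g_def left_diff_distrib mult.assoc ii power2_eq_square scaleR_add_right add.commute)
  finally have ug: "u * g = g * (n *\<^sub>R i)" .
  show ?thesis
  proof
    show "norm (inverse (norm g) *\<^sub>R g) = 1"
      using g0 by simp
    show "u * (inverse (norm g) *\<^sub>R g) = inverse (norm g) *\<^sub>R g * (norm u *\<^sub>R Quat 0 1 0 0)"
      using ug by (simp add: n_def i_def)
  qed
qed

text \<open>Conjugation by \<open>h\<close> carries the centralizer of \<open>u\<close> to the
  centralizer of \<open>i\<close>, which consists of the complex quaternions.\<close>

lemma is_complex_quat_conj:
  assumes "norm h = 1" "u \<noteq> 0" "u * h = h * (norm u *\<^sub>R Quat 0 1 0 0)" "x * u = u * x"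
  shows "is_complex_quat (qconj h * x * h)"
proof -
  let ?i = "Quat 0 1 0 0" let ?x = "qconj h * x * h"
  have hu: "qconj h * u = (norm u *\<^sub>R ?i) * qconj h"
  proof -
    have "qconj h * u = qconj h * (u * h) * qconj h"
      by (simp add: mult.assoc unit_qconj[OF assms(1)])
    also have "\<dots> = (norm u *\<^sub>R ?i) * qconj h"
      by (simp only: assms(3)) (simp add: mult.assoc[symmetric] unit_qconj[OF assms(1)])
    finally show ?thesis .
  qed
  have "?x * (norm u *\<^sub>R ?i) = qconj h * (x * u) * h"
    using assms(3) by (simp add: mult.assoc)
  also have "\<dots> = (qconj h * u) * (x * h)"
    by (simp add: assms(4) mult.assoc)
  also have "\<dots> = (norm u *\<^sub>R ?i) * ?x"
    by (simp add: hu mult.assoc)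
  finally have "?x * ?i = ?i * ?x"
    using assms(2) by simp
  then show ?thesis
    unfolding is_complex_quat_def by (simp only: quat_eq_iff) (simp add: quat_sel_mult[of _ ?i] quat_sel_mult[of ?i])
qed

lemma mscal_conj_sel:
  fixes h :: quat and A :: mat2
  assumes "norm h = 1"
  defines "B \<equiv> mmult (mmult (mscal (inverse h)) A) (mscal h)"
  shows "m11 B = qconj h * m11 A * h" "m12 B = qconj h * m12 A * h"
    "m21 B = qconj h * m21 A * h" "m22 B = qconj h * m22 A * h"
  using assms(1) by (simp_all add: B_def mmult_def mscal_def inverse_unit)

lemma mscal_in_Sp11: "norm h = 1 \<Longrightarrow> mscal h \<in> Sp11"
  unfolding Sp11_iff by (simp add: mat2_eq_iff mscal_def unit_qconj)

lemma mscal_conj_Sp11: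
  assumes "norm h = 1" "A \<in> Sp11"
  shows "mmult (mmult (mscal (inverse h)) A) (mscal h) \<in> Sp11"
  using assms Sp11_mult[OF Sp11_mult[OF mscal_in_Sp11[of "inverse h"] assms(2)] mscal_in_Sp11[of h]]
  by (simp add: times_mat2_def norm_inverse)

text \<open>For a complex matrix of determinant 1 the classical adjugate is the inverse, and so is
  \<open>adj B\<close>. Comparing entries makes the diagonal conjugate, so the trace is real, and
  conjugation by \<open>h\<close> fixes real numbers.\<close>

lemma SU11_conj_trace_real:
  assumes "norm h = 1" "mmult (mmult (mscal (inverse h)) A) (mscal h) \<in> SU11"
  shows "mtrace A \<in> \<real>"
proof -
  define B where "B = mmult (mmult (mscal (inverse h)) A) (mscal h)"
  define C where "C = M2 (m22 B) (- m12 B) (- m21 B) (m11 B)"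
  have cx: "qj (m11 B) = 0" "qk (m11 B) = 0" "qj (m12 B) = 0" "qk (m12 B) = 0"
    "qj (m21 B) = 0" "qk (m21 B) = 0" "qj (m22 B) = 0" "qk (m22 B) = 0"
    and det: "m11 B * m22 B - m12 B * m21 B = 1" and inv: "adj B * B = 1"
    using assms(2) by (auto simp: SU11_def is_complex_quat_def Sp11_iff B_def[symmetric] simp del: mat2_sel_mult)
  have comm: "x * y = y * x" if "qj x = 0" "qk x = 0" "qj y = 0" "qk y = 0" for x y
    using that by (simp add: quat_eq_iff quat_sel_mult)
  have "B * C = 1"
    using det comm[of "m12 B" "m11 B"] comm[of "m22 B" "m21 B"] comm[of "m21 B" "m12 B"] comm[of "m22 B" "m11 B"] cx
    by (simp add: mat2_eq_iff C_def)
  then have "adj B = C"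
    using inv by (metis mult.assoc mult_1 mult_1_right)
  then have "qconj (m11 B) = m22 B"
    by (simp add: mat2_eq_iff C_def)
  then have "qconj (mtrace B) = mtrace B"
    unfolding mtrace_def by (metis add.commute qconj_simps(3,6))
  then have "mtrace B \<in> \<real>"
    by (simp only: qconj_real_iff)
  then obtain t where "mtrace B = of_real t"
    by (auto simp: Reals_def)
  moreover have "mtrace B = qconj h * mtrace A * h"
    unfolding mtrace_def B_def mscal_conj_sel[OF assms(1)] by (simp add: algebra_simps)
  moreover have "mtrace A = h * (qconj h * mtrace A * h) * qconj h"
    by (simp add: mult.assoc unit_qconj[OF assms(1)])
  ultimately have "mtrace A = h * of_real t * qconj h"
    by simp
  then have "mtrace A = of_real t"
    by (simp add: of_real_def unit_qconj[OF assms(1)])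
  then show ?thesis
    by simp
qed

lemma range_qreal: "range qreal = \<real>"
  by (auto simp: Reals_def qreal_eq_of_real)

lemma trace_field_real:
  assumes "\<And>A. A \<in> G \<Longrightarrow> mtrace A \<in> \<real>"
  shows "trace_field G \<subseteq> \<real>"
proof
  fix x assume "x \<in> trace_field G"
  then show "x \<in> \<real>"
    by induction (use assms in auto)
qed

context real_trace_group
begin

lemma conj_into_SU11:
  assumes "p \<in> poles" "q \<in> poles" "r \<in> poles" "p \<noteq> q" "q \<noteq> r" "p \<noteq> r"
  shows "\<exists>h. norm h = 1 \<and> (\<forall>A\<in>G. mmult (mmult (mscal (inverse h)) A) (mscal h) \<in> SU11)"
proof -
  obtain u where u: "u \<noteq> 0" "qconj u = - u"
    and ent: "\<And>A. A \<in> G \<Longrightarrow> m11 A * u = u * m11 A \<and> m12 A * u = u * m12 A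
           \<and> m21 A = qconj (m12 A) \<and> m22 A = qconj (m11 A)"
    using common_complex_line[OF assms] by metis
  obtain h where h: "norm h = 1" "u * h = h * (norm u *\<^sub>R Quat 0 1 0 0)"
    using imaginary_conjugate_to_i[OF u(2,1)] .
  have "mmult (mmult (mscal (inverse h)) A) (mscal h) \<in> SU11" if A: "A \<in> G" for A
  proof -
    note e = ent[OF A]
    have c: "m21 A * u = u * m21 A" "m22 A * u = u * m22 A"
      using e commute_qconj[OF u(2)] by metis+
    have "qre (m11 A * qconj (m11 A) - m12 A * qconj (m12 A)) = 1"
      using Sp11_norm(1)[OF Sp11[OF A]] by (simp add: mult_qconj del: of_real_power)
    moreover have "m11 A * qconj (m11 A) - m12 A * qconj (m12 A) \<in> \<real>"
      by (simp add: mult_qconj)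
    \<comment> \<open>Given the shape of \<open>A\<close>, its determinant is the norm identity for
      the first row.\<close>
    ultimately have det: "m11 A * m22 A - m12 A * m21 A = 1"
      using e by (metis Reals_cases of_real_1 quat_sel_of_real(1))
    have "qconj h * m11 A * h * (qconj h * m22 A * h) - qconj h * m12 A * h * (qconj h * m21 A * h)
        = qconj h * (m11 A * m22 A - m12 A * m21 A) * h"
      by (simp add: mult.assoc unit_qconj[OF h(1)] right_diff_distrib left_diff_distrib)
    also have "\<dots> = 1"
      by (simp only: det mult_1_right unit_qconj[OF h(1)])
    finally have "qconj h * m11 A * h * (qconj h * m22 A * h) - qconj h * m12 A * h * (qconj h * m21 A * h) = 1" .
    moreover have "is_complex_quat (qconj h * m11 A * h)" "is_complex_quat (qconj h * m12 A * h)"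
      "is_complex_quat (qconj h * m21 A * h)" "is_complex_quat (qconj h * m22 A * h)"
      using is_complex_quat_conj[OF h(1) u(1) h(2)] e c by blast+
    ultimately show ?thesis
      unfolding SU11_def mem_Collect_eq mscal_conj_sel[OF h(1)]
      using mscal_conj_Sp11[OF h(1) Sp11[OF A]] by blast
  qed
  then show ?thesis
    using h(1) by blast
qed

end

section \<open>Limit points and fixed points\<close>

text \<open>Convergence is entrywise, as \<open>mat2\<close> is only given an algebra structure and
  no topology.\<close>

definition mlim :: "(nat \<Rightarrow> mat2) \<Rightarrow> mat2 \<Rightarrow> bool" where
  "mlim f X \<longleftrightarrow> (\<lambda>n. m11 (f n)) \<longlonglongrightarrow> m11 X \<and> (\<lambda>n. m12 (f n)) \<longlonglongrightarrow> m12 X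
     \<and> (\<lambda>n. m21 (f n)) \<longlonglongrightarrow> m21 X \<and> (\<lambda>n. m22 (f n)) \<longlonglongrightarrow> m22 X"

lemma mlim_mult: "mlim f X \<Longrightarrow> mlim g Y \<Longrightarrow> mlim (\<lambda>n. f n * g n) (X * Y)"
  unfolding mlim_def by (auto intro!: tendsto_intros)

lemma mlim_adj: "mlim f X \<Longrightarrow> mlim (\<lambda>n. adj (f n)) (adj X)"
  unfolding mlim_def by (auto intro!: tendsto_intros)

lemma mlim_subseq: "mlim f X \<Longrightarrow> strict_mono r \<Longrightarrow> mlim (\<lambda>n. f (r n)) X"
  unfolding mlim_def using LIMSEQ_subseq_LIMSEQ[of _ _ r] by (auto simp: o_def)

lemma mlim_frm: "mlim f X \<Longrightarrow> (\<lambda>n. frm p (f n) q) \<longlonglongrightarrow> frm p X q"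
  unfolding mlim_def frm_def by (auto intro!: tendsto_intros)

lemma mlim_const: "mlim (\<lambda>n. X) X"
  by (simp add: mlim_def)

lemma mlim_unique: "mlim f X \<Longrightarrow> mlim f Y \<Longrightarrow> X = Y"
  unfolding mlim_def mat2_eq_iff by (blast intro: LIMSEQ_unique)

lemma mlim_scaleR: "(\<lambda>n. r n) \<longlonglongrightarrow> t \<Longrightarrow> mlim (\<lambda>n. r n *\<^sub>R X) (t *\<^sub>R X)"
  unfolding mlim_def by (auto intro!: tendsto_intros)

lemma mlim_mdist:
  assumes "mlim f X"
  shows "(\<lambda>n. Defs.mdist X (f n)) \<longlonglongrightarrow> 0"
proof -
  have "(\<lambda>n. Defs.mdist X (f n)) \<longlonglongrightarrow> sqrt ((norm (m11 X - m11 X))\<^sup>2 + (norm (m12 X - m12 X))\<^sup>2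
      + (norm (m21 X - m21 X))\<^sup>2 + (norm (m22 X - m22 X))\<^sup>2)"
    unfolding Defs.mdist_def norm_quat_def[symmetric]
    using assms by (intro tendsto_intros) (auto simp: mlim_def)
  then show ?thesis by simp
qed

lemma mlim_bounded_subseq:
  assumes "\<And>n. norm (m11 (f n)) \<le> K \<and> norm (m12 (f n)) \<le> K \<and> norm (m21 (f n)) \<le> K \<and> norm (m22 (f n)) \<le> K"
  obtains X r where "strict_mono (r :: nat \<Rightarrow> nat)" "mlim (\<lambda>n. f (r n)) X"
proof -
  define F where "F n = (m11 (f n), m12 (f n), m21 (f n), m22 (f n))" for n
  have "norm (F n) \<le> K + (K + (K + K))" for n
    unfolding F_def using assms[of n] by (intro order_trans[OF norm_Pair_le] add_mono) auto
  then have "bounded (range F)"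
    by (auto simp: bounded_iff)
  then obtain l r where r: "strict_mono (r :: nat \<Rightarrow> nat)" "(F \<circ> r) \<longlonglongrightarrow> l"
    using bounded_imp_convergent_subsequence by blast
  obtain a b c d where l: "l = (a, b, c, d)"
    by (cases l) auto
  have "mlim (\<lambda>n. f (r n)) (M2 a b c d)"
    using tendsto_fst[OF r(2)] tendsto_fst[OF tendsto_snd[OF r(2)]]
      tendsto_fst[OF tendsto_snd[OF tendsto_snd[OF r(2)]]] tendsto_snd[OF tendsto_snd[OF tendsto_snd[OF r(2)]]]
    by (simp add: mlim_def l F_def o_def)
  then show ?thesis
    using that r(1) by blast
qed

lemma trace_hull_mlim:
  assumes "\<And>n. f n \<in> trace_hull G" "mlim f X"
  shows "X \<in> trace_hull G"
  unfolding trace_hull_def mem_Collect_eq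
proof (intro allI impI)
  fix M assume M: "\<forall>A\<in>G. qre (mtrace (M * A)) = 0"
  have "(\<lambda>n. qre (mtrace (M * f n))) \<longlonglongrightarrow> qre (mtrace (M * X))"
    using mlim_mult[OF mlim_const[of M] assms(2)] unfolding mlim_def mtrace_def by (intro tendsto_intros) auto
  moreover have "qre (mtrace (M * f n)) = 0" for n
    using M assms(1)[of n] by (simp add: trace_hull_def)
  ultimately show "qre (mtrace (M * X)) = 0"
    by (simp add: LIMSEQ_const_iff)
qed

section \<open>Rank-one limits, fixed points and multipliers\<close>

lemma frm_scaleR: "frm p (r *\<^sub>R A) q = r *\<^sub>R frm p A q"
  by (simp add: frm_def algebra_simps)

lemma frm_outer: "frm p (outer a d b) q = frm p 1 a * d * frm b 1 q"
  by (simp add: frm_def algebra_simps)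

text \<open>A null vector is orthogonal only to its own line within the null cone; thus for
  \<open>A\<close> in \<open>Sp11\<close>, \<open>frm q A q = 0\<close> encodes that
  \<open>A\<close> fixes the boundary point \<open>q\<close>.\<close>

lemma frm_self_eq_0_iff:
  assumes "norm q = 1"
  shows "frm q A q = 0 \<longleftrightarrow> m11 A * q + m12 A = q * (m21 A * q + m22 A)"
proof -
  have "q * frm q A q = q * (m21 A * q + m22 A) - (m11 A * q + m12 A)"
    by (simp only: frm_def right_diff_distrib unit_qconj(3)[OF assms])
  moreover have "q \<noteq> 0" using assms by auto
  ultimately show ?thesis
    by (metis eq_iff_diff_eq_0 mult_eq_0_iff)
qed

text \<open>Dividing \<open>g n\<close> by \<open>norm (m22 (g n))\<close> bounds all entries by 1,
  so a subsequence converges to some \<open>X\<close>. The factors tend to 0, hence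
  \<open>X * adj X = 0\<close>; together with \<open>m12 X = p * m22 X\<close> this forces the
  rank-one form.\<close>

lemma limit_point_outer:
  assumes "G \<subseteq> Sp11" "p \<in> limit_set G"
  obtains A r d q where "\<And>n. A n \<in> G" "r \<longlonglongrightarrow> 0" "mlim (\<lambda>n. r n *\<^sub>R A n) (outer p d q)"
    "norm d = 1" "norm q = 1" "norm p = 1"
proof -
  obtain g where np: "norm p = 1" and g: "\<And>n. g n \<in> G"
    and "(\<lambda>n. norm (mobius (g n) 0 - p)) \<longlonglongrightarrow> 0"
    using assms(2) by (auto simp: limit_set_def norm_quat_def)
  then have mob: "(\<lambda>n. mobius (g n) 0) \<longlonglongrightarrow> p"
    by (simp add: tendsto_norm_zero_iff LIM_zero_iff)
  have S: "g n \<in> Sp11" for n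
    using g assms(1) by auto
  define \<rho> where "\<rho> n = inverse (norm (m22 (g n)))" for n
  define f where "f n = \<rho> n *\<^sub>R g n" for n
  have m22: "m22 (g n) \<noteq> 0" for n
    using Sp11_norm(5)[OF S] .
  have b_eq: "m12 (f n) = mobius (g n) 0 * m22 (f n)" for n
    using m22[of n] by (simp add: f_def mobius_def mult.assoc)
  have n22: "norm (m22 (f n)) = 1" for n
    using m22[of n] by (simp add: f_def \<rho>_def)
  have n11: "norm (m11 (f n)) = 1" for n
    using m22[of n] Sp11_norm(3)[OF S, of n] by (simp add: f_def \<rho>_def)
  have n12: "norm (m12 (f n)) = norm (mobius (g n) 0)" for n
    by (simp add: b_eq norm_mult n22)
  \<comment> \<open>The norm of \<open>m12 (f n)\<close> is that of \<open>mobius (g n) 0\<close>,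
    which tends to \<open>norm p = 1\<close>; hence the scaling factors tend to 0.\<close>
  have rho_sq: "(\<rho> n)\<^sup>2 = 1 - (norm (m12 (f n)))\<^sup>2" for n
  proof -
    have "(\<rho> n)\<^sup>2 * (norm (m22 (g n)))\<^sup>2 = 1"
      using m22[of n] by (simp add: \<rho>_def power_mult_distrib[symmetric])
    moreover have "(\<rho> n)\<^sup>2 * (norm (m22 (g n)))\<^sup>2 = (\<rho> n)\<^sup>2 + (\<rho> n)\<^sup>2 * (norm (m12 (g n)))\<^sup>2"
      by (simp add: Sp11_norm(2)[OF S] distrib_left)
    moreover have "(norm (m12 (f n)))\<^sup>2 = (\<rho> n)\<^sup>2 * (norm (m12 (g n)))\<^sup>2"
      by (simp add: f_def power_mult_distrib)
    ultimately show ?thesis by linarith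
  qed
  have n12_le: "norm (m12 (f n)) \<le> 1" for n
  proof -
    have "(norm (m12 (f n)))\<^sup>2 \<le> 1\<^sup>2"
      using rho_sq[of n] zero_le_power2[of "\<rho> n"] by simp
    then show ?thesis by (rule power2_le_imp_le) simp
  qed
  have n21: "norm (m21 (f n)) = norm (m12 (f n))" for n
    using Sp11_norm(4)[OF S, of n] by (simp add: f_def)
  have "(\<lambda>n. 1 - (norm (mobius (g n) 0))\<^sup>2) \<longlonglongrightarrow> 1 - (norm p)\<^sup>2"
    by (intro tendsto_intros mob)
  then have rho2: "(\<lambda>n. (\<rho> n)\<^sup>2) \<longlonglongrightarrow> 0"
    by (simp add: rho_sq n12 np)
  then have "(\<lambda>n. sqrt ((\<rho> n)\<^sup>2)) \<longlonglongrightarrow> sqrt 0"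
    by (intro tendsto_intros)
  moreover have "sqrt ((\<rho> n)\<^sup>2) = \<rho> n" for n
    by (simp add: \<rho>_def)
  ultimately have rho: "\<rho> \<longlonglongrightarrow> 0"
    by simp
  obtain X r where r: "strict_mono (r :: nat \<Rightarrow> nat)" and X: "mlim (\<lambda>n. f (r n)) X"
    using mlim_bounded_subseq[of f 1] n11 n12_le n21 n22 by (metis order_refl)
  have "(\<lambda>n. norm (m11 (f (r n)))) \<longlonglongrightarrow> norm (m11 X)" "(\<lambda>n. norm (m22 (f (r n)))) \<longlonglongrightarrow> norm (m22 X)"
    using X by (auto simp: mlim_def intro!: tendsto_intros)
  then have nX: "norm (m11 X) = 1" "norm (m22 X) = 1"
    by (simp_all add: n11 n22 LIMSEQ_const_iff)
  have "(\<lambda>n. mobius (g (r n)) 0 * m22 (f (r n))) \<longlonglongrightarrow> p * m22 X"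
    using X LIMSEQ_subseq_LIMSEQ[OF mob r] by (auto simp: mlim_def o_def intro!: tendsto_intros)
  moreover have "(\<lambda>n. mobius (g (r n)) 0 * m22 (f (r n))) \<longlonglongrightarrow> m12 X"
    using X by (simp add: mlim_def b_eq)
  ultimately have bX: "m12 X = p * m22 X"
    by (rule LIMSEQ_unique[symmetric])
  have "f n * adj (f n) = (\<rho> n)\<^sup>2 *\<^sub>R 1" for n
  proof -
    have "f n * adj (f n) = (\<rho> n)\<^sup>2 *\<^sub>R (g n * adj (g n))"
      by (simp add: mat2_eq_iff f_def power2_eq_square algebra_simps)
    then show ?thesis
      using S[of n] by (simp add: Sp11_iff)
  qed
  then have "mlim (\<lambda>n. (\<rho> (r n))\<^sup>2 *\<^sub>R 1) (X * adj X)"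
    using mlim_mult[OF X mlim_adj[OF X]] by simp
  moreover have "mlim (\<lambda>n. (\<rho> (r n))\<^sup>2 *\<^sub>R 1) (0 *\<^sub>R 1)"
    using LIMSEQ_subseq_LIMSEQ[OF rho2 r] by (intro mlim_scaleR) (simp add: o_def)
  ultimately have "X * adj X = 0 *\<^sub>R 1"
    by (rule mlim_unique)
  then have "m12 (X * adj X) = 0"
    by (simp del: mat2_sel_mult)
  then have "m11 X * qconj (m21 X) = p * (m22 X * qconj (m22 X))"
    by (simp add: bX mult.assoc)
  then have "m11 X * qconj (m21 X) = p"
    by (simp add: unit_qconj nX)
  then have "qconj (m21 X) = qconj (m11 X) * p"
    by (metis nX(1) unit_qconj(4))
  then have cX: "m21 X = qconj p * m11 X"
    by (metis qconj_mult qconj_simps(6))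
  \<comment> \<open>Obtained by solving \<open>m11 X = - (p * m22 X * qconj q)\<close> for
    \<open>q\<close>.\<close>
  define q where "q = - (qconj (m11 X) * p * m22 X)"
  have "X = outer p (m22 X) q"
    using nX np by (simp add: mat2_eq_iff q_def bX cX mult.assoc unit_qconj)
  then have "mlim (\<lambda>n. \<rho> (r n) *\<^sub>R g (r n)) (outer p (m22 X) q)"
    using X by (simp add: f_def)
  moreover have "norm q = 1"
    using nX np by (simp add: q_def norm_mult)
  moreover have "(\<lambda>n. \<rho> (r n)) \<longlonglongrightarrow> 0"
    using LIMSEQ_subseq_LIMSEQ[OF rho r] by (simp add: o_def)
  ultimately show ?thesis
    using that[of "\<lambda>n. g (r n)" "\<lambda>n. \<rho> (r n)" "m22 X" q] g nX(2) np by blast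
qed

text \<open>A kernel element satisfies \<open>z * v = l * z\<close>, so unequal norms of
  \<open>v\<close> and \<open>l\<close> make the map injective, hence onto in finite
  dimension.\<close>

lemma linear_sylvester_surj:
  fixes l v m :: quat
  assumes "norm v \<noteq> norm l"
  obtains z where "z * v - l * z = m"
proof -
  have lin: "linear (\<lambda>z. z * v - l * z)"
    by (rule linearI) (simp_all add: algebra_simps)
  have "inj (\<lambda>z. z * v - l * z)"
    unfolding linear_injective_0[OF lin]
  proof (intro allI impI)
    fix z assume "z * v - l * z = 0"
    then have "norm (z * v) = norm (l * z)"
      by simp
    then show "z = 0"
      using assms by (simp add: norm_mult)
  qed
  then have "surj (\<lambda>z. z * v - l * z)"
    by (rule linear_injective_imp_surjective[OF lin]) (rule refl)
  then obtain z where "m = z * v - l * z"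
    by (rule surjE)
  then show ?thesis
    using that[of z] by simp
qed

text \<open>In the basis \<open>v_q\<close>, \<open>w = (q, -1)\<close> the matrix \<open>A\<close> is triangular with diagonal \<open>l, v\<close> where
  \<open>l^* v = 1\<close>. The second fixed point is the eigenline of \<open>v_q z + w\<close>, where \<open>z v - l z = m\<close>; that line is
  null because \<open>A\<close> scales its form by \<open>\<bar>v\<bar>\<^sup>2 \<noteq> 1\<close>.\<close>

lemma second_fixed_point:
  assumes A: "A \<in> Sp11" and q: "norm q = 1" "frm q A q = 0" "norm (m21 A * q + m22 A) \<noteq> 1"
  obtains q' where "norm q' = 1" "q' \<noteq> q" "frm q' A q' = 0"
proof -
  define l where "l = m21 A * q + m22 A"
  \<comment> \<open>\<open>m\<close> and \<open>v\<close> are the coordinates in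
    \<open>A w = v_q m + w v\<close>, recovered as half sum and half difference.\<close>
  define v where "v = (1/2) *\<^sub>R (qconj q * (m11 A * q - m12 A) - (m21 A * q - m22 A))"
  define m where "m = (1/2) *\<^sub>R (qconj q * (m11 A * q - m12 A) + (m21 A * q - m22 A))"
  have Aq: "m11 A * q + m12 A = q * l"
    using q by (simp add: frm_self_eq_0_iff l_def)
  have half: "(1/2) *\<^sub>R (x + y) + (1/2) *\<^sub>R (x - y) = x" "(1/2) *\<^sub>R (x + y) - (1/2) *\<^sub>R (x - y) = y"
    for x y :: quat
    by (simp_all add: quat_eq_iff field_simps)
  have mv: "m + v = qconj q * (m11 A * q - m12 A)" "m - v = m21 A * q - m22 A"
    unfolding m_def v_def by (rule half)+
  have qmv: "q * m + q * v = m11 A * q - m12 A"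
    using mv(1) by (simp add: distrib_left[symmetric] unit_qconj(3)[OF q(1)])
  \<comment> \<open>Invariance of the pairing of \<open>v_q\<close> with \<open>w\<close>, whose
    value is -2.\<close>
  have "qconj l * (m21 A * q - m22 A) - qconj (q * l) * (m11 A * q - m12 A) = - 1 - qconj q * q"
    using Sp11_form_invariant[OF A, of q 1 q "-1"] by (simp add: l_def[symmetric] Aq del: qconj_mult)
  then have "qconj l * ((m - v) - (m + v)) = - 2"
    by (simp only: mv) (simp add: right_diff_distrib mult.assoc unit_qconj[OF q(1)])
  then have "(- 2) *\<^sub>R (qconj l * v) = (- 2) *\<^sub>R 1"
    by (simp add: scaleR_2 algebra_simps)
  then have lv: "qconj l * v = 1"
    by simp
  then have nlv: "norm l * norm v = 1"
    using norm_mult[of "qconj l" v] by simp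
  have nl1: "norm l \<noteq> 1"
    using q(3) l_def by simp
  have nv1: "norm v \<noteq> 1"
    using nlv nl1 by auto
  have "norm v \<noteq> norm l"
  proof
    assume "norm v = norm l"
    then have "(norm l)\<^sup>2 = 1"
      using nlv by (simp add: power2_eq_square)
    then show False
      using nl1 by (simp add: power2_eq_1_iff) (metis norm_not_less_zero less_minus_one_simps(1))
  qed
  then obtain z where z: "z * v - l * z = m"
    by (rule linear_sylvester_surj)
  \<comment> \<open>The coordinates of \<open>v_q z + w\<close>, an eigenvector with right
    eigenvalue \<open>v\<close>.\<close>
  define x y where "x = q * z + q" and "y = z - 1"
  have e1: "m11 A * x + m12 A * y = x * v"
  proof -
    have "m11 A * x + m12 A * y = (m11 A * q + m12 A) * z + (m11 A * q - m12 A)"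
      by (simp add: x_def y_def algebra_simps)
    also have "\<dots> = q * l * z + (q * m + q * v)"
      by (simp only: Aq qmv)
    also have "\<dots> = q * (l * z + m) + q * v"
      by (simp add: algebra_simps)
    finally show ?thesis
      using z by (simp add: x_def algebra_simps)
  qed
  have e2: "m21 A * x + m22 A * y = y * v"
  proof -
    have "m21 A * x + m22 A * y = l * z + (m21 A * q - m22 A)"
      by (simp add: x_def y_def l_def algebra_simps)
    also have "\<dots> = l * z + m - v"
      by (simp add: mv(2)[symmetric])
    finally show ?thesis
      using z by (simp add: y_def algebra_simps)
  qed
  have "qconj (y * v) * (y * v) - qconj (x * v) * (x * v) = qconj y * y - qconj x * x"
    using Sp11_form_invariant[OF A, of x y x y] by (simp only: e1 e2)
  then have "of_real ((norm (y * v))\<^sup>2 - (norm (x * v))\<^sup>2) = (of_real ((norm y)\<^sup>2 - (norm x)\<^sup>2) :: quat)"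
    by (simp only: mult_qconj of_real_diff)
  then have "((norm v)\<^sup>2 - 1) * ((norm y)\<^sup>2 - (norm x)\<^sup>2) = 0"
    unfolding of_real_eq_iff norm_mult power_mult_distrib by (simp add: algebra_simps)
  moreover have "(norm v)\<^sup>2 \<noteq> 1"
    using nv1 by (simp add: power2_eq_1_iff) (metis norm_not_less_zero less_minus_one_simps(1))
  ultimately have nxy: "norm x = norm y"
    by (simp add: power2_eq_iff_nonneg)
  have q0: "q \<noteq> 0"
    using q(1) by auto
  have xq: "x \<noteq> q * y"
  proof
    assume "x = q * y"
    then have "q + q = 0"
      by (simp add: x_def y_def algebra_simps)
    then show False
      using q0 by (simp add: scaleR_2[symmetric])
  qed
  have y0: "y \<noteq> 0"
    using xq nxy by auto
  define q' where "q' = x * inverse y"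
  have x: "x = q' * y"
    using y0 by (simp add: q'_def mult.assoc)
  show ?thesis
  proof
    show n1: "norm q' = 1"
      using y0 by (simp add: q'_def norm_mult norm_inverse nxy)
    show "q' \<noteq> q"
      using xq x by auto
    have "(m21 A * q' + m22 A) * y = y * v"
      using e2 by (simp add: x algebra_simps)
    moreover have "(m11 A * q' + m12 A) * y = q' * (y * v)"
      using e1 by (simp add: x algebra_simps)
    ultimately have "(m11 A * q' + m12 A - q' * (m21 A * q' + m22 A)) * y = 0"
      by (simp only: left_diff_distrib mult.assoc) simp
    then show "frm q' A q' = 0"
      using y0 by (simp only: frm_self_eq_0_iff[OF n1] mult_eq_0_iff right_minus_eq simp_thms)
  qed
qed

lemma fixed_multiplier_adj:
  assumes "A \<in> Sp11" "norm q = 1" "frm q A q = 0"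
  shows "(m21 (adj A) * q + m22 (adj A)) * (m21 A * q + m22 A) = 1"
proof -
  have e: "m11 A * q + m12 A = q * (m21 A * q + m22 A)"
    using assms by (simp add: frm_self_eq_0_iff)
  have "(m21 (adj A) * q + m22 (adj A)) * (m21 A * q + m22 A)
      = m21 (adj A) * (q * (m21 A * q + m22 A)) + m22 (adj A) * (m21 A * q + m22 A)"
    by (simp only: distrib_right mult.assoc)
  also have "\<dots> = m21 (adj A * A) * q + m22 (adj A * A)"
    by (simp only: e[symmetric]) (simp add: algebra_simps)
  also have "\<dots> = 1"
    using assms(1) by (simp add: Sp11_iff del: mat2_sel_mult)
  finally show ?thesis .
qed

text \<open>Both points are fixed, so \<open>A v_q\<close> is \<open>v_q\<close> times its
  multiplier, and adjointly \<open>v_p^* adj A\<close> is the conjugate multiplier times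
  \<open>v_p^*\<close>.\<close>

lemma frm_conjugate:
  assumes "norm p = 1" "norm q = 1" "frm p A p = 0" "frm q A q = 0"
  shows "frm p (adj A * M * A) q = qconj (m21 A * p + m22 A) * frm p M q * (m21 A * q + m22 A)"
proof -
  define k l where "k = m21 A * p + m22 A" and "l = m21 A * q + m22 A"
  have e: "m11 A * p + m12 A = p * k" "m11 A * q + m12 A = q * l"
    using assms by (simp_all add: frm_self_eq_0_iff k_def l_def)
  have "frm p (adj A * M * A) q = qconj k * (m21 M * (m11 A * q + m12 A) + m22 M * l)
      - qconj (m11 A * p + m12 A) * (m11 M * (m11 A * q + m12 A) + m12 M * l)"
    by (simp add: frm_def k_def l_def algebra_simps)
  also have "\<dots> = qconj k * frm p M q * l"
    by (simp add: e) (simp add: frm_def algebra_simps)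
  finally show ?thesis
    by (simp add: k_def l_def)
qed

text \<open>The four values of \<open>frm\<close> are the matrix of the form of \<open>B\<close> in
  the basis \<open>v_p\<close>, \<open>v_q\<close>, so they control all entries, with a bound
  depending on \<open>K\<close> and the distance of the points.\<close>

lemma entries_bounded:
  assumes "p \<noteq> q" "norm p = 1" "norm q = 1"
  obtains L where "\<And>B. norm (frm p B p) \<le> K \<Longrightarrow> norm (frm p B q) \<le> K \<Longrightarrow> norm (frm q B p) \<le> K \<Longrightarrow>
    norm (frm q B q) \<le> K \<Longrightarrow> norm (m11 B) \<le> L \<and> norm (m12 B) \<le> L \<and> norm (m21 B) \<le> L \<and> norm (m22 B) \<le> L"
proof -
  define \<delta> where "\<delta> = norm (p - q)"
  have d0: "\<delta> > 0"
    using assms(1) by (simp add: \<delta>_def)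
  \<comment> \<open>\<open>D\<close> and \<open>E\<close> bound the first and second coordinates of
    \<open>B v_p\<close> and \<open>B v_q\<close>; \<open>L\<close> then bounds the entries.\<close>
  define D where "D = 2 * K / \<delta>"
  define E where "E = D + K"
  define L where "L = 2 * E / \<delta> + E"
  have *: "norm (m11 B * x + m12 B) \<le> D \<and> norm (m21 B * x + m22 B) \<le> E"
    if "norm (frm p B x) \<le> K" "norm (frm q B x) \<le> K" for B x
  proof -
    have "qconj (p - q) * (m11 B * x + m12 B) = frm q B x - frm p B x"
      by (simp add: frm_def algebra_simps)
    then have "\<delta> * norm (m11 B * x + m12 B) = norm (frm q B x - frm p B x)"
      unfolding \<delta>_def using norm_mult[of "qconj (p - q)" "m11 B * x + m12 B"] by (simp only: norm_qconj)
    also have "\<dots> \<le> 2 * K"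
      using norm_triangle_ineq4[of "frm q B x" "frm p B x"] that by linarith
    finally have 1: "norm (m11 B * x + m12 B) \<le> D"
      using d0 by (simp add: D_def field_simps)
    have "m21 B * x + m22 B = frm p B x + qconj p * (m11 B * x + m12 B)"
      by (simp add: frm_def)
    then have "norm (m21 B * x + m22 B) \<le> norm (frm p B x) + norm (qconj p * (m11 B * x + m12 B))"
      using norm_triangle_ineq by simp
    then show ?thesis
      using 1 that assms(2) by (simp add: E_def norm_mult)
  qed
  have **: "norm a \<le> L \<and> norm b \<le> L" if "norm (a * p + b) \<le> E" "norm (a * q + b) \<le> E" for a b
  proof -
    have "a * (p - q) = (a * p + b) - (a * q + b)"
      by (simp add: algebra_simps)
    then have "norm a * \<delta> = norm ((a * p + b) - (a * q + b))"
      unfolding \<delta>_def using norm_mult[of a "p - q"] by simp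
    also have "\<dots> \<le> 2 * E"
      using norm_triangle_ineq4[of "a * p + b" "a * q + b"] that by linarith
    finally have 1: "norm a \<le> 2 * E / \<delta>"
      using d0 by (simp add: field_simps)
    have E0: "E \<ge> 0"
      using that(1) norm_ge_zero order_trans by blast
    have "norm b \<le> norm (a * p + b) + norm (a * p)"
      using norm_triangle_ineq4[of "a * p + b" "a * p"] by simp
    then show ?thesis
      using 1 that(1) E0 assms(2) by (simp add: L_def norm_mult)
  qed
  show ?thesis
  proof
    fix B assume B: "norm (frm p B p) \<le> K" "norm (frm p B q) \<le> K" "norm (frm q B p) \<le> K" "norm (frm q B q) \<le> K"
    have "K \<ge> 0"
      using B(1) norm_ge_zero order_trans by blast
    then have "norm (m11 B * x + m12 B) \<le> E" if "norm (m11 B * x + m12 B) \<le> D" for x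
      using that by (simp add: E_def)
    then show "norm (m11 B) \<le> L \<and> norm (m12 B) \<le> L \<and> norm (m21 B) \<le> L \<and> norm (m22 B) \<le> L"
      using *[OF B(1,3)] *[OF B(2,4)] **[of "m11 B" "m12 B"] **[of "m21 B" "m22 B"] by blast
  qed
qed

section \<open>Limit sets of groups with fixed points, and discreteness\<close>

context Sp11_subgroup
begin

lemma limit_point_outer_group:
  assumes "p \<in> limit_set G"
  obtains A r d q where "\<forall>n. A n \<in> G" "r \<longlonglongrightarrow> 0" "mlim (\<lambda>n. r n *\<^sub>R A n) (outer p d q)"
    "norm d = 1" "norm q = 1" "norm p = 1"
  using limit_point_outer[OF subsetI[OF Sp11] assms] by metis

text \<open>Taking adjoints of the rescaled elements places \<open>p\<close> on the side that is
  paired with \<open>q0\<close>. Their multipliers at \<open>q0\<close> have norm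
  \<open>\<bar>r n\<bar>\<close>, which tends to 0, so \<open>v_p\<close> and \<open>v_q0\<close>
  are orthogonal.\<close>

lemma isometric_at_fixed_point_limit_set:
  assumes "norm q0 = 1" "\<And>A. A \<in> G \<Longrightarrow> norm (m21 A * q0 + m22 A) = 1" "p \<in> limit_set G"
  shows "p = q0"
proof -
  obtain A r d q where AG: "\<forall>n. A n \<in> G" and r: "r \<longlonglongrightarrow> 0" and l: "mlim (\<lambda>n. r n *\<^sub>R A n) (outer p d q)"
    and n: "norm d = 1" "norm q = 1" "norm p = 1"
    using limit_point_outer_group[OF assms(3)] .
  have A: "A n \<in> G" for n
    using AG by blast
  have "mlim (\<lambda>n. adj (r n *\<^sub>R A n)) (outer q (qconj d) p)"
    using mlim_adj[OF l] by (simp add: adj_outer)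
  then have lim: "(\<lambda>n. norm (m21 (adj (r n *\<^sub>R A n)) * q0 + m22 (adj (r n *\<^sub>R A n))))
     \<longlonglongrightarrow> norm (m21 (outer q (qconj d) p) * q0 + m22 (outer q (qconj d) p))"
    unfolding mlim_def by (intro tendsto_intros) auto
  have norm_eq: "norm (m21 (adj (r n *\<^sub>R A n)) * q0 + m22 (adj (r n *\<^sub>R A n))) = \<bar>r n\<bar>" for n
  proof -
    have "m21 (adj (r n *\<^sub>R A n)) * q0 + m22 (adj (r n *\<^sub>R A n))
        = r n *\<^sub>R (m21 (adj (A n)) * q0 + m22 (adj (A n)))"
      by (simp add: algebra_simps)
    then show ?thesis
      using assms(2)[OF adj_closed[OF A[of n]]] by (simp del: adj_sel)
  qed
  have "(\<lambda>n. \<bar>r n\<bar>) \<longlonglongrightarrow> 0"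
    using r by (rule tendsto_rabs_zero)
  with lim have "norm (m21 (outer q (qconj d) p) * q0 + m22 (outer q (qconj d) p)) = 0"
    unfolding norm_eq by (rule LIMSEQ_unique)
  moreover have "m21 (outer q (qconj d) p) * q0 + m22 (outer q (qconj d) p) = qconj d * frm p 1 q0"
    by (simp add: frm_one algebra_simps)
  ultimately have "frm p 1 q0 = 0"
    using n(1) by auto
  then show ?thesis
    using frm_one_eq_0_iff[OF n(3)] by metis
qed

text \<open>At a common fixed point \<open>s\<close> the vanishing of \<open>frm s A s\<close>
  survives rescaled limits, so \<open>p = s\<close> or \<open>q = s\<close>. As \<open>q\<close>
  cannot equal both fixed points, \<open>p\<close> equals one.\<close>

lemma two_fixed_points_limit_set:
  assumes "norm q1 = 1" "norm q2 = 1" "q1 \<noteq> q2"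
    and fixed: "\<And>A. A \<in> G \<Longrightarrow> frm q1 A q1 = 0" "\<And>A. A \<in> G \<Longrightarrow> frm q2 A q2 = 0"
    and "p \<in> limit_set G"
  shows "p = q1 \<or> p = q2"
proof -
  obtain A r d q where AG: "\<forall>n. A n \<in> G" and l: "mlim (\<lambda>n. r n *\<^sub>R A n) (outer p d q)"
    and n: "norm d = 1" "norm q = 1" "norm p = 1"
    using limit_point_outer_group[OF assms(6)] by metis
  have A: "A n \<in> G" for n
    using AG by blast
  have "p = s \<or> q = s" if s: "norm s = 1" "\<And>A. A \<in> G \<Longrightarrow> frm s A s = 0" for s
  proof -
    have "(\<lambda>n. frm s (r n *\<^sub>R A n) s) \<longlonglongrightarrow> frm s (outer p d q) s"
      by (rule mlim_frm[OF l])
    then have "frm s (outer p d q) s = 0"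
      by (simp add: frm_scaleR s(2)[OF A] LIMSEQ_const_iff)
    then have "frm s 1 p = 0 \<or> frm q 1 s = 0"
      using n(1) by (auto simp: frm_outer)
    then show ?thesis
      using frm_one_eq_0_iff[OF s(1)] frm_one_eq_0_iff[OF n(2)] by metis
  qed
  from this[OF assms(1) fixed(1)] this[OF assms(2) fixed(2)] show ?thesis
    using assms(3) by metis
qed

text \<open>Two distinct limit points exclude that all multipliers at \<open>q\<close> have norm 1;
  passing to the inverse makes the norm exceed 1.\<close>

lemma ex_expanding_element:
  assumes "norm q = 1" "\<And>A. A \<in> G \<Longrightarrow> frm q A q = 0" "p1 \<in> limit_set G" "p2 \<in> limit_set G" "p1 \<noteq> p2"
  obtains g where "g \<in> G" "norm (m21 g * q + m22 g) > 1"
proof -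
  obtain g where g: "g \<in> G" "norm (m21 g * q + m22 g) \<noteq> 1"
    using isometric_at_fixed_point_limit_set[OF assms(1)] assms(3-5) by metis
  show ?thesis
  proof (cases "norm (m21 g * q + m22 g) > 1")
    case True
    then show ?thesis using that g(1) by blast
  next
    case False
    have "norm (m21 (adj g) * q + m22 (adj g)) * norm (m21 g * q + m22 g) = 1"
      using fixed_multiplier_adj[OF Sp11[OF g(1)] assms(1) assms(2)[OF g(1)]]
      by (metis norm_mult norm_one)
    then have "norm (m21 (adj g) * q + m22 (adj g)) > 1"
      using False g(2) mult_left_le[of "norm (m21 g * q + m22 g)" "norm (m21 (adj g) * q + m22 (adj g))"]
      by (smt (verit, ccfv_threshold) mult_less_cancel_right2 mult_le_cancel_right2 norm_ge_zero)
    then show ?thesis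
      using that adj_closed[OF g(1)] by blast
  qed
qed

text \<open>Otherwise the conjugates \<open>g^{-n} A g^n\<close> are pairwise distinct and bounded, because conjugation scales
  the coefficient \<open>frm q2 A q2\<close> by a factor less than 1 and preserves the norms of the others.\<close>

lemma discrete_loxodromic_fixed_points:
  assumes discrete: "discrete_set G"
    and q: "norm q1 = 1" "norm q2 = 1" "q1 \<noteq> q2"
    and fixed: "\<And>A. A \<in> G \<Longrightarrow> frm q1 A q1 = 0"
    and g: "g \<in> G" "norm (m21 g * q1 + m22 g) > 1" "frm q2 g q2 = 0"
    and A: "A \<in> G"
  shows "frm q2 A q2 = 0"
proof (rule ccontr)
  assume ne: "frm q2 A q2 \<noteq> 0"
  define k1 k2 where "k1 = m21 g * q1 + m22 g" and "k2 = m21 g * q2 + m22 g"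
  define B where "B n = ((\<lambda>X. adj g * X * g) ^^ n) A" for n
  have BG: "B n \<in> G" for n
    unfolding B_def by (induction n) (simp_all add: A mult_closed adj_closed g(1))
  have conj: "frm p (adj g * X * g) p' = qconj (m21 g * p + m22 g) * frm p X p' * (m21 g * p' + m22 g)"
    if "p \<in> {q1, q2}" "p' \<in> {q1, q2}" for p p' X
    using that q fixed[OF g(1)] g(3) by (intro frm_conjugate) auto
  have "adj g * 1 * g = 1"
    using Sp11[OF g(1)] by (simp add: Sp11_iff)
  \<comment> \<open>Conjugation fixes the identity, so the multipliers at the two fixed points have
    reciprocal norms.\<close>
  then have "norm (frm q1 1 q2) = norm k1 * norm (frm q1 1 q2) * norm k2"
    using arg_cong[OF conj[of q1 q2 1], of norm]
    by (simp add: norm_mult k1_def k2_def del: qconj_simps qconj_mult)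
  moreover have "frm q1 1 q2 \<noteq> 0"
    using frm_one_eq_0_iff[OF q(1)] q(3) by metis
  ultimately have kk: "norm k1 * norm k2 = 1"
    by (simp add: field_simps)
  have k1: "norm k1 > 1"
    using g(2) by (simp add: k1_def)
  have k2: "0 < norm k2" "norm k2 < 1"
  proof -
    show "0 < norm k2"
      using kk by (cases "k2 = 0") auto
    then have "1 * norm k2 < norm k1 * norm k2"
      using k1 by (intro mult_strict_right_mono)
    then show "norm k2 < 1"
      using kk by simp
  qed
  have step: "norm (frm p (B (Suc n)) p') = norm (m21 g * p + m22 g) * norm (frm p (B n) p') * norm (m21 g * p' + m22 g)"
    if "p \<in> {q1, q2}" "p' \<in> {q1, q2}" for p p' n
    using arg_cong[OF conj[OF that, of "B n"], of norm]
    by (simp add: B_def norm_mult del: qconj_simps qconj_mult)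
  have kk': "norm k1 * x * norm k2 = x" "norm k2 * x * norm k1 = x" for x
    using kk by (metis mult.assoc mult.commute mult_1)+
  have y12: "norm (frm q1 (B n) q2) = norm (frm q1 A q2)" for n
  proof (induction n)
    case (Suc n)
    then show ?case
      using step[of q1 q2 n] by (simp add: k1_def[symmetric] k2_def[symmetric] kk')
  qed (simp add: B_def)
  have y21: "norm (frm q2 (B n) q1) = norm (frm q2 A q1)" for n
  proof (induction n)
    case (Suc n)
    then show ?case
      using step[of q2 q1 n] by (simp add: k1_def[symmetric] k2_def[symmetric] kk')
  qed (simp add: B_def)
  have y22: "norm (frm q2 (B n) q2) = ((norm k2)\<^sup>2) ^ n * norm (frm q2 A q2)" for n
  proof (induction n)
    case (Suc n)
    then show ?case
      using step[of q2 q2 n] by (simp add: k2_def power2_eq_square mult_ac)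
  qed (simp add: B_def)
  have t: "0 < (norm k2)\<^sup>2" "(norm k2)\<^sup>2 < 1"
    using k2 by (auto simp: power_less_one_iff)
  define K where "K = norm (frm q1 A q2) + norm (frm q2 A q1) + norm (frm q2 A q2)"
  obtain L where L: "\<And>X. norm (frm q1 X q1) \<le> K \<Longrightarrow> norm (frm q1 X q2) \<le> K \<Longrightarrow> norm (frm q2 X q1) \<le> K \<Longrightarrow>
    norm (frm q2 X q2) \<le> K \<Longrightarrow> norm (m11 X) \<le> L \<and> norm (m12 X) \<le> L \<and> norm (m21 X) \<le> L \<and> norm (m22 X) \<le> L"
    using entries_bounded[OF q(3,1,2), of K] by metis
  have bd: "norm (m11 (B n)) \<le> L \<and> norm (m12 (B n)) \<le> L \<and> norm (m21 (B n)) \<le> L \<and> norm (m22 (B n)) \<le> L" for n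
  proof (rule L)
    show "norm (frm q1 (B n) q1) \<le> K"
      using fixed[OF BG[of n]] by (simp add: K_def)
    have "((norm k2)\<^sup>2) ^ n * norm (frm q2 A q2) \<le> norm (frm q2 A q2)"
      using t by (intro mult_left_le_one_le) (auto simp: power_le_one)
    then show "norm (frm q2 (B n) q2) \<le> K"
      unfolding y22 K_def by (smt (verit) norm_ge_zero)
  qed (simp_all add: y12 y21 K_def)
  obtain Z r where r: "strict_mono (r :: nat \<Rightarrow> nat)" and Z: "mlim (\<lambda>n. B (r n)) Z"
    using mlim_bounded_subseq[OF bd] .
  have inv: "adj (B n) * B n = 1" "B n * adj (B n) = 1" for n
    using Sp11[OF BG[of n]] by (simp_all add: Sp11_iff)
  have "mlim (\<lambda>n. adj (B (r n)) * B (r n)) (adj Z * Z)"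
    by (rule mlim_mult[OF mlim_adj[OF Z] Z])
  then have ZZ: "adj Z * Z = 1"
    using mlim_unique[OF mlim_const[of 1]] inv by simp
  \<comment> \<open>Quotients of consecutive terms of the convergent subsequence lie in
    \<open>G\<close> and tend to 1, so discreteness at the identity makes two terms equal, although
    their \<open>frm\<close> values at \<open>q2\<close> strictly decrease in norm.\<close>
  define C where "C n = adj (B (r n)) * B (r (Suc n))" for n
  have "mlim (\<lambda>n. B (r (Suc n))) Z"
    using mlim_subseq[OF Z, of Suc] by (simp add: strict_mono_def)
  then have "mlim C 1"
    using mlim_mult[OF mlim_adj[OF Z], of "\<lambda>n. B (r (Suc n))" Z] ZZ by (simp add: C_def[abs_def])
  then have lim: "(\<lambda>n. Defs.mdist 1 (C n)) \<longlonglongrightarrow> 0"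
    by (rule mlim_mdist)
  obtain e where e: "e > 0" "\<And>X. X \<in> G \<Longrightarrow> Defs.mdist 1 X < e \<Longrightarrow> X = 1"
    using discrete one_closed unfolding discrete_set_def by blast
  have "eventually (\<lambda>n. Defs.mdist 1 (C n) < e) sequentially"
    using order_tendstoD(2)[OF lim e(1)] .
  then obtain n where "Defs.mdist 1 (C n) < e"
    by (auto simp: eventually_sequentially)
  then have "C n = 1"
    using e(2) BG adj_closed mult_closed by (simp add: C_def)
  then have "B (r n) * (adj (B (r n)) * B (r (Suc n))) = B (r n)"
    by (simp add: C_def)
  then have "B (r (Suc n)) = B (r n)"
    by (simp add: mult.assoc[symmetric] inv)
  then have "((norm k2)\<^sup>2) ^ r (Suc n) = ((norm k2)\<^sup>2) ^ r n"
    using y22[of "r n"] y22[of "r (Suc n)"] ne by simp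
  moreover have "r n < r (Suc n)"
    using r by (simp add: strict_mono_def)
  ultimately show False
    using power_strict_decreasing[OF _ t] by (metis less_irrefl)
qed

text \<open>A common fixed point would give an expanding element, whose second fixed point is then
  fixed by all of \<open>G\<close> by discreteness. The limit set would have at most two
  points.\<close>

lemma no_global_fixed_point:
  assumes "discrete_set G" "nonelementary G" "norm q = 1"
  obtains A where "A \<in> G" "frm q A q \<noteq> 0"
proof (rule ccontr)
  assume "\<not> thesis"
  then have fixed: "\<And>A. A \<in> G \<Longrightarrow> frm q A q = 0"
    using that by blast
  obtain a b c where abc: "a \<in> limit_set G" "b \<in> limit_set G" "c \<in> limit_set G" "a \<noteq> b" "b \<noteq> c" "a \<noteq> c"
    using assms(2) by (auto simp: nonelementary_def)
  obtain g where g: "g \<in> G" "norm (m21 g * q + m22 g) > 1"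
    using ex_expanding_element[OF assms(3) fixed abc(1,2,4)] .
  then have ne1: "norm (m21 g * q + m22 g) \<noteq> 1"
    by simp
  obtain q' where q': "norm q' = 1" "q' \<noteq> q" "frm q' g q' = 0"
    using second_fixed_point[OF Sp11[OF g(1)] assms(3) fixed[OF g(1)] ne1] .
  have fixed': "frm q' A q' = 0" if "A \<in> G" for A
    using discrete_loxodromic_fixed_points[OF assms(1,3) q'(1) q'(2)[symmetric] fixed g q'(3) that] .
  have "p = q \<or> p = q'" if "p \<in> limit_set G" for p
    using two_fixed_points_limit_set[OF assms(3) q'(1) q'(2)[symmetric] fixed fixed' that] .
  then show False
    using abc by metis
qed

end

section \<open>Limit points are poles\<close>

context real_trace_group
begin

text \<open>The rescaled limit \<open>outer p d q\<close> may have \<open>q \<noteq> p\<close>.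
  Multiplying it by an element that moves \<open>q\<close> and then by its own adjoint gives a
  nonzero coefficient with \<open>p\<close> on both sides.\<close>

lemma limit_point_in_poles:
  assumes "discrete_set G" "nonelementary G" "p \<in> limit_set G"
  shows "p \<in> poles"
proof -
  obtain A r d q where AG: "\<forall>n. A n \<in> G" and l: "mlim (\<lambda>n. r n *\<^sub>R A n) (outer p d q)"
    and n: "norm d = 1" "norm q = 1" "norm p = 1"
    using limit_point_outer_group[OF assms(3)] by metis
  have A: "A n \<in> G" for n
    using AG by blast
  have X: "outer p d q \<in> trace_hull G"
    using trace_hull_mlim[OF _ l] trace_hull_base[OF A] trace_hull_scaleR by blast
  obtain B where B: "B \<in> G" "frm q B q \<noteq> 0"
    using no_global_fixed_point[OF assms(1,2) n(2)] .
  have "outer p d q * B * outer q (qconj d) p \<in> trace_hull G"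
    using X trace_hull_adj[OF X] trace_hull_base[OF B(1)] by (simp add: adj_outer trace_hull_mult)
  then have "outer p (d * frm q B q * qconj d) p \<in> trace_hull G"
    by (simp only: outer_mult_mult_outer)
  moreover have "d * frm q B q * qconj d \<noteq> 0"
    using B(2) n(1) by auto
  ultimately show ?thesis
    using n(3) unfolding poles_def by blast
qed

end

theorem theorem4p4:
  fixes \<Gamma> :: "mat2 set"
  assumes "subgroup_Sp11 \<Gamma>" and "discrete_set \<Gamma>" and "nonelementary \<Gamma>"
  shows "trace_field \<Gamma> \<subseteq> range qreal \<longleftrightarrow>
    (\<exists>h. qnorm h = 1 \<and>
       (\<forall>A\<in>\<Gamma>. mmult (mmult (mscal (inverse h)) A) (mscal h) \<in> SU11))"
proof
  have Sp: "A \<in> Sp11" if "A \<in> \<Gamma>" for A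
    using that assms(1) by (auto simp: subgroup_Sp11_def)
  interpret Sp11_subgroup \<Gamma>
  proof
    show "A \<in> \<Gamma> \<Longrightarrow> A \<in> Sp11" for A
      by (rule Sp)
    show "1 \<in> \<Gamma>" "A \<in> \<Gamma> \<Longrightarrow> B \<in> \<Gamma> \<Longrightarrow> A * B \<in> \<Gamma>" for A B
      using assms(1) by (auto simp: subgroup_Sp11_def one_mat2_def times_mat2_def)
    fix A assume A: "A \<in> \<Gamma>"
    then obtain B where "B \<in> \<Gamma>" "A * B = 1"
      using assms(1) by (auto simp: subgroup_Sp11_def one_mat2_def times_mat2_def)
    moreover have "adj A * A = 1"
      using Sp[OF A] by (simp add: Sp11_iff)
    ultimately show "adj A \<in> \<Gamma>"
      by (metis mult.assoc mult_1 mult_1_right)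
  qed
  assume tf: "trace_field \<Gamma> \<subseteq> range qreal"
  interpret real_trace_group \<Gamma>
    by standard (use tf tf_trace range_qreal in blast)
  \<comment> \<open>Three distinct limit points supply the three distinct poles that the algebraic
    part requires.\<close>
  obtain p q r where "p \<in> limit_set \<Gamma>" "q \<in> limit_set \<Gamma>" "r \<in> limit_set \<Gamma>" "p \<noteq> q" "q \<noteq> r" "p \<noteq> r"
    using assms(3) by (auto simp: nonelementary_def)
  then show "\<exists>h. qnorm h = 1 \<and> (\<forall>A\<in>\<Gamma>. mmult (mmult (mscal (inverse h)) A) (mscal h) \<in> SU11)"
    using conj_into_SU11 limit_point_in_poles[OF assms(2,3)] unfolding norm_quat_def by metis
next
  assume "\<exists>h. qnorm h = 1 \<and> (\<forall>A\<in>\<Gamma>. mmult (mmult (mscal (inverse h)) A) (mscal h) \<in> SU11)"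
  then show "trace_field \<Gamma> \<subseteq> range qreal"
    unfolding range_qreal norm_quat_def[symmetric] using SU11_conj_trace_real trace_field_real by metis
qed

end
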